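(* Let $\lambda$ be a regular cardinal with $\lambda \geq \omega_2$, and assume that the semi-stationary reflection principle $\mathrm{SSR}(\lambda)$ holds. Then $\square(\lambda)$ fails.
   Context: Stationarity: for an uncountable regular cardinal $\kappa$ and a set $A \supseteq \kappa$, $C \subseteq [A]^{<\kappa}$ is club if it is $\subseteq$-cofinal in $[A]^{<\kappa}$ and closed under unions of $\subseteq$-increasing sequences of length $<\kappa$; $S \subseteq [A]^{<\kappa}$ is stationary if it meets every club. $X \subseteq [A]^{\omega}$ is stationary (club) in $[A]^\omega$ if it is stationary (club) in $[A]^{<\omega_1}$. For countable sets $x,y$, write $x \sqsubseteq y$ if $x \subseteq y$ and $x \cap \omega_1 = y \cap \omega_1$. A set $S \subseteq [\lambda]^\omega$ is full if $x \in S$, $y \in [\lambda]^\omega$ and $x \sqsubseteq y$ imply $y \in S$. $\mathrm{SSR}(\lambda)$: for every full stationary $S \subseteq [\lambda]^\omega$ there is $I \subseteq \lambda$ of cardinality $\omega_1$ such that $\omega_1 \subseteq I$ and $S \cap [I]^\omega$ is stationary in $[I]^\omega$. For a set $A$ of ordinals, $\lim(A)$ is the set of limit points of $A$ lying in $A$; in particular $\lim(\lambda)$ is the set of nonzero limit ordinals below $\lambda$. $\square(\lambda)$: there is a sequence $(C_\alpha : \alpha \in \lim(\lambda))$ such that (i) $C_\alpha$ is a club subset of $\alpha$ for all $\alpha$; (ii) if $\alpha \in \lim(C_\beta)$ then $C_\alpha = C_\beta \cap \alpha$; (iii) there is no club $C \subseteq \lambda$ with $C \cap \alpha = C_\alpha$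 for all $\alpha \in \lim(C)$. *)

theory Defs
  imports Main
begin

unbundle cardinal_syntax

text \<open>
  Cardinals and ordinals are represented by well-orders, as in the library theory of cardinal
  orders. If \<open>r\<close> is a cardinal order (\<open>Card_order r\<close>) of cardinality \<open>\<lambda>\<close>, then \<open>Field r\<close> has
  order type \<open>\<lambda>\<close> and plays the role of the set \<open>\<lambda>\<close> of all ordinals below \<open>\<lambda>\<close>; an element
  \<open>\<alpha>\<close> of \<open>Field r\<close> is such an ordinal, \<open>(\<alpha>, \<beta>) \<in> r\<close> means \<open>\<alpha> \<le> \<beta>\<close>, and \<open>underS r \<alpha>\<close> is
  the set of ordinals below \<open>\<alpha>\<close>, that is, \<open>\<alpha>\<close> as a von Neumann ordinal.
\<close>

definition omega1 :: "nat set rel" where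
  "omega1 = cardSuc natLeq"

definition omega2 :: "nat set set rel" where
  "omega2 = cardSuc omega1"

text \<open>The set \<open>\<omega>\<^sub>1\<close> of ordinals, as a subset of \<open>\<lambda> = Field r\<close>: the \<open>\<alpha>\<close> whose order type is
  less than \<open>\<omega>\<^sub>1\<close>. It has order type \<open>\<omega>\<^sub>1\<close> only when \<open>\<lambda> \<ge> \<omega>\<^sub>1\<close>.\<close>

definition omega1_in :: "'a rel \<Rightarrow> 'a set" where
  "omega1_in r = {\<alpha> \<in> Field r. Restr r (underS r \<alpha>) <o omega1}"


subsection \<open>Clubs and stationary sets of small subsets\<close>

text \<open>\<open>[A]\<^bsup><\<kappa>\<^esup>\<close>, where \<open>k\<close> is a cardinal order of cardinality \<open>\<kappa>\<close>.\<close>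

definition small_subsets :: "'k rel \<Rightarrow> 'a set \<Rightarrow> 'a set set" where
  "small_subsets k A = {x. x \<subseteq> A \<and> |x| <o k}"

text \<open>The sequences of length \<open>< \<kappa>\<close> are those indexed by \<open>underS k \<xi>\<close> for \<open>\<xi>\<close> in \<open>Field k\<close>.
  The empty sequence is excluded, so that a club need not contain the empty set.\<close>

definition club_small :: "'k rel \<Rightarrow> 'a set \<Rightarrow> 'a set set \<Rightarrow> bool" where
  "club_small k A C \<longleftrightarrow>
     C \<subseteq> small_subsets k A \<and>
     (\<forall>x \<in> small_subsets k A. \<exists>y \<in> C. x \<subseteq> y) \<and>
     (\<forall>\<xi> \<in> Field k. \<forall>f. underS k \<xi> \<noteq> {} \<longrightarrow>
        (\<forall>i \<in> underS k \<xi>. f i \<in> C) \<longrightarrow>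
        (\<forall>i \<in> underS k \<xi>. \<forall>j \<in> underS k \<xi>. (i, j) \<in> k \<longrightarrow> f i \<subseteq> f j) \<longrightarrow>
        (\<Union>i \<in> underS k \<xi>. f i) \<in> C)"

definition stationary_small :: "'k rel \<Rightarrow> 'a set \<Rightarrow> 'a set set \<Rightarrow> bool" where
  "stationary_small k A S \<longleftrightarrow>
     S \<subseteq> small_subsets k A \<and> (\<forall>C. club_small k A C \<longrightarrow> S \<inter> C \<noteq> {})"

text \<open>\<open>[A]\<^sup>\<omega>\<close> consists of the subsets of cardinality exactly \<open>\<omega>\<close>. Stationarity in \<open>[A]\<^sup>\<omega>\<close> is
  by convention stationarity in \<open>[A]\<^bsup><\<omega>\<^sub>1\<^esup>\<close>.\<close>

definition omega_subsets :: "'a set \<Rightarrow> 'a set set" where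
  "omega_subsets A = {x. x \<subseteq> A \<and> |x| =o natLeq}"

definition stationary_omega :: "'a set \<Rightarrow> 'a set set \<Rightarrow> bool" where
  "stationary_omega A X \<longleftrightarrow> X \<subseteq> omega_subsets A \<and> stationary_small omega1 A X"


subsection \<open>Semi-stationary reflection\<close>

definition omega1_ext :: "'a rel \<Rightarrow> 'a set \<Rightarrow> 'a set \<Rightarrow> bool" where
  "omega1_ext r x y \<longleftrightarrow> x \<subseteq> y \<and> x \<inter> omega1_in r = y \<inter> omega1_in r"

definition full :: "'a rel \<Rightarrow> 'a set set \<Rightarrow> bool" where
  "full r S \<longleftrightarrow>
     (\<forall>x \<in> S. \<forall>y \<in> omega_subsets (Field r). omega1_ext r x y \<longrightarrow> y \<in> S)"

definition SSR :: "'a rel \<Rightarrow> bool" where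
  "SSR r \<longleftrightarrow>
     (\<forall>S. S \<subseteq> omega_subsets (Field r) \<longrightarrow> full r S \<longrightarrow> stationary_omega (Field r) S \<longrightarrow>
        (\<exists>I. I \<subseteq> Field r \<and> |I| =o omega1 \<and> omega1_in r \<subseteq> I \<and>
             stationary_omega I (S \<inter> omega_subsets I)))"


subsection \<open>The square principle\<close>

text \<open>\<open>\<alpha>\<close> is a limit point of \<open>A\<close> if \<open>\<alpha> \<noteq> 0\<close> and \<open>sup (A \<inter> \<alpha>) = \<alpha>\<close>; the strict bound
  \<open>\<beta> < \<gamma>\<close> excludes successor ordinals.\<close>

definition limit_point :: "'a rel \<Rightarrow> 'a set \<Rightarrow> 'a \<Rightarrow> bool" where
  "limit_point r A \<alpha> \<longleftrightarrow>
     \<alpha> \<in> Field r \<and> underS r \<alpha> \<noteq> {} \<and>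
     (\<forall>\<beta> \<in> underS r \<alpha>. \<exists>\<gamma> \<in> A \<inter> underS r \<alpha>. \<beta> \<in> underS r \<gamma>)"

definition lim_points :: "'a rel \<Rightarrow> 'a set \<Rightarrow> 'a set" where
  "lim_points r A = {\<alpha> \<in> A. limit_point r A \<alpha>}"

text \<open>Here \<open>D\<close> is an ordinal \<open>\<le> \<lambda>\<close>, i.e. \<open>Field r\<close> or \<open>underS r \<alpha>\<close>: \<open>C\<close> is closed and
  unbounded in \<open>D\<close>.\<close>

definition club_in :: "'a rel \<Rightarrow> 'a set \<Rightarrow> 'a set \<Rightarrow> bool" where
  "club_in r D C \<longleftrightarrow>
     C \<subseteq> D \<and>
     (\<forall>\<beta> \<in> D. \<exists>\<gamma> \<in> C. (\<beta>, \<gamma>) \<in> r) \<and>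
     (\<forall>\<delta> \<in> D. limit_point r C \<delta> \<longrightarrow> \<delta> \<in> C)"

definition square :: "'a rel \<Rightarrow> bool" where
  "square r \<longleftrightarrow>
     (\<exists>C :: 'a \<Rightarrow> 'a set.
        (\<forall>\<alpha> \<in> lim_points r (Field r). club_in r (underS r \<alpha>) (C \<alpha>)) \<and>
        (\<forall>\<beta> \<in> lim_points r (Field r). \<forall>\<alpha> \<in> lim_points r (C \<beta>).
           C \<alpha> = C \<beta> \<inter> underS r \<alpha>) \<and>
        \<not> (\<exists>D. club_in r (Field r) D \<and>
              (\<forall>\<alpha> \<in> lim_points r D. D \<inter> underS r \<alpha> = C \<alpha>)))"

end

theory Submission
  imports Defs "HOL-Library.Countable_Set_Type"
begin

text \<open>
  Let \<open>(C\<^sub>\<alpha>)\<close> be a \<open>\<box>(\<lambda>)\<close>-sequence. By coherence \<open>C\<^sub>\<beta> \<inter> \<eta>\<close> takes fewer than \<open>\<lambda>\<close> values as \<open>\<beta>\<close>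
  varies. Since there is no thread, for some \<open>\<eta> < \<lambda>\<close> uncountably many of these values occur
  for stationarily many \<open>\<beta>\<close> of cofinality \<open>\<omega>\<close>; let \<open>c\<^sub>\<xi>\<close>, \<open>\<xi> < \<omega>\<^sub>1\<close>, be distinct such values.
  Let \<open>S\<close> be the full set generated by the countable \<open>y\<close> such that \<open>\<beta> = sup y\<close> is a limit not
  in \<open>y\<close>, \<open>y \<inter> \<omega>\<^sub>1 = \<xi>\<close> is an ordinal and \<open>C\<^sub>\<beta> \<inter> \<eta> = c\<^sub>\<xi>\<close>. A game argument yields, for every club,
  some \<open>\<xi>\<close> such that almost every \<open>\<beta>\<close> of cofinality \<open>\<omega>\<close> is the supremum of a member \<open>y\<close> of the
  club with \<open>y \<inter> \<omega>\<^sub>1 = \<xi>\<close>; so \<open>S\<close> is stationary.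

  Suppose that \<open>S \<inter> [I]\<^sup>\<omega>\<close> is stationary with \<open>|I| = \<omega>\<^sub>1\<close>. For \<open>i \<le> sup I\<close> put \<open>\<delta>\<^sub>i = sup (I \<inter> i)\<close>. Take
  \<open>x \<subseteq> I\<close> in \<open>S\<close> that is sufficiently closed, and \<open>y \<subseteq> x\<close>, \<open>\<beta>\<close>, \<open>\<xi>\<close> as above. If \<open>i\<close> is the least
  element \<open>\<ge> \<beta>\<close> of \<open>x \<union> {sup I}\<close>, then \<open>\<beta>\<close> is \<open>\<delta>\<^sub>i\<close> or a limit point of \<open>C\<^bsub>\<delta>\<^sub>i\<^esub>\<close>, so
  \<open>c\<^sub>\<xi> = C\<^bsub>\<delta>\<^sub>i\<^esub> \<inter> \<eta>\<close>. This determines \<open>\<xi>\<close> from \<open>i\<close>, so \<open>\<xi> \<in> x\<close> by closure, contradicting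
  \<open>x \<inter> \<omega>\<^sub>1 = \<xi>\<close>.
\<close>

section \<open>Countability expressed through \<open>omega1\<close>\<close>

lemma ordLess_omega1_iff_countable: "|x| <o omega1 \<longleftrightarrow> countable x"
  unfolding omega1_def countable_card_le_natLeq
  using cardSuc_ordLeq_ordLess[OF natLeq_Card_order card_of_Card_order] by blast

lemma omega1_Card_order: "Card_order omega1"
  unfolding omega1_def by (rule cardSuc_Card_order[OF natLeq_Card_order])

lemma uncountable_iff_omega1_ordLeq: "uncountable x \<longleftrightarrow> omega1 \<le>o |x|"
proof -
  have "Well_order omega1" using omega1_Card_order unfolding card_order_on_def by (rule conjunct1)
  then show ?thesis
    using not_ordLess_iff_ordLeq[OF _ card_of_Well_order] ordLess_omega1_iff_countable[of x]
    by metis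
qed

lemma small_subsets_omega1: "small_subsets omega1 A = {x. x \<subseteq> A \<and> countable x}"
  by (simp add: small_subsets_def ordLess_omega1_iff_countable)

lemma omega_subsets_iff: "x \<in> omega_subsets A \<longleftrightarrow> x \<subseteq> A \<and> countable x \<and> infinite x"
  unfolding omega_subsets_def
  unfolding countable_card_le_natLeq ordIso_iff_ordLeq
  using infinite_iff_natLeq_ordLeq[of x] by blast

subsection \<open>Regular cardinals above \<open>\<omega>\<^sub>1\<close>\<close>

locale regular_order =
  fixes r :: "'a rel"
  assumes Card: "Card_order r" and Reg: "regularCard r" and Big: "omega2 \<le>o r"
begin

abbreviation lt :: "'a \<Rightarrow> 'a \<Rightarrow> bool" (infix \<open>\<lhd>\<close> 50)
  where "x \<lhd> y \<equiv> x \<in> underS r y"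

abbreviation le :: "'a \<Rightarrow> 'a \<Rightarrow> bool" (infix \<open>\<unlhd>\<close> 50)
  where "x \<unlhd> y \<equiv> (x, y) \<in> r"

lemma wo: "Well_order r"
  using Card unfolding card_order_on_def by blast

lemma wo_rel: "wo_rel r"
  using wo by (simp add: wo_rel_def)

lemma lt_Field: "x \<lhd> y \<Longrightarrow> x \<in> Field r \<and> y \<in> Field r"
  by (auto simp: underS_def Field_def)

lemma le_Field: "x \<unlhd> y \<Longrightarrow> x \<in> Field r \<and> y \<in> Field r"
  by (auto simp: Field_def)

lemma lt_imp_le: "x \<lhd> y \<Longrightarrow> x \<unlhd> y"
  by (auto simp: underS_def)

lemma lt_irrefl: "\<not> x \<lhd> x"
  by (auto simp: underS_def)

lemma le_refl: "x \<in> Field r \<Longrightarrow> x \<unlhd> x"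
  using wo_rel.REFL[OF wo_rel] by (auto simp: refl_on_def)

lemma le_antisym: "x \<unlhd> y \<Longrightarrow> y \<unlhd> x \<Longrightarrow> x = y"
  using wo_rel.ANTISYM[OF wo_rel] by (auto simp: antisym_def)

lemma le_trans: "x \<unlhd> y \<Longrightarrow> y \<unlhd> z \<Longrightarrow> x \<unlhd> z"
  using wo_rel.TRANS[OF wo_rel] by (auto simp: trans_def)

lemma le_cases: "x \<unlhd> y \<Longrightarrow> x \<lhd> y \<or> x = y"
  by (auto simp: underS_def)

lemma lt_le_trans: "x \<lhd> y \<Longrightarrow> y \<unlhd> z \<Longrightarrow> x \<lhd> z"
  unfolding underS_def using le_trans le_antisym by blast

lemma le_lt_trans: "x \<unlhd> y \<Longrightarrow> y \<lhd> z \<Longrightarrow> x \<lhd> z"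
  unfolding underS_def using le_trans le_antisym by blast

lemma lt_trans: "x \<lhd> y \<Longrightarrow> y \<lhd> z \<Longrightarrow> x \<lhd> z"
  using le_lt_trans lt_imp_le by blast

lemma not_lt_iff: "x \<in> Field r \<Longrightarrow> y \<in> Field r \<Longrightarrow> \<not> x \<lhd> y \<longleftrightarrow> y \<unlhd> x"
  unfolding underS_def using le_antisym wo_rel.TOTALS[OF wo_rel] le_refl by blast

lemma underS_mono: "x \<unlhd> y \<Longrightarrow> underS r x \<subseteq> underS r y"
  using lt_le_trans by blast

lemma least_exists:
  assumes "a \<in> Field r" "P a"
  obtains b where "b \<in> Field r" "P b" "\<And>c. c \<lhd> b \<Longrightarrow> \<not> P c" "b \<unlhd> a"
proof -
  let ?A = "{x \<in> Field r. P x}"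
  have A: "?A \<subseteq> Field r" "?A \<noteq> {}" using assms by auto
  let ?b = "wo_rel.minim r ?A"
  have b: "?b \<in> ?A" using wo_rel.minim_in[OF wo_rel A] .
  have l: "?b \<unlhd> x" if "x \<in> ?A" for x using wo_rel.minim_least[OF wo_rel A(1) that] .
  have "\<not> P c" if "c \<lhd> ?b" for c
    using that l lt_Field le_lt_trans lt_irrefl by blast
  then show ?thesis using that b l assms by blast
qed

lemma lt_induct [consumes 1, case_names less]:
  assumes "a \<in> Field r"
    and "\<And>a. a \<in> Field r \<Longrightarrow> (\<And>b. b \<lhd> a \<Longrightarrow> P b) \<Longrightarrow> P a"
  shows "P a"
proof (rule ccontr)
  assume "\<not> P a"
  with assms(1) obtain b where "b \<in> Field r" "\<not> P b" "\<And>c. c \<lhd> b \<Longrightarrow> \<not> \<not> P c"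
    using least_exists[of a "\<lambda>x. \<not> P x"] by blast
  then show False using assms(2) by blast
qed

lemma omega1_lt: "omega1 <o r"
proof -
  have "omega1 <o omega2"
    unfolding omega2_def by (rule cardSuc_greater[OF omega1_Card_order])
  then show ?thesis using Big by (rule ordLess_ordLeq_trans)
qed

lemma natLeq_lt: "natLeq <o r"
  using cardSuc_greater[OF natLeq_Card_order] omega1_lt
  unfolding omega1_def by (rule ordLess_transitive)

lemma infinite_Field: "infinite (Field r)"
proof
  assume "finite (Field r)"
  then have "|Field r| <o natLeq"
    using finite_iff_ordLess_natLeq by blast
  then have "r <o natLeq"
    using card_of_Field_ordIso[OF Card] ordIso_ordLess_trans ordIso_symmetric by blast
  then show False using natLeq_lt ordLess_transitive ordLess_irreflexive by blast
qed

lemma gt_exists: "a \<in> Field r \<Longrightarrow> \<exists>b. a \<lhd> b"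
  using infinite_Card_order_limit[OF Card infinite_Field] unfolding underS_def by blast

text \<open>By regularity a set of fewer than \<lambda> ordinals is not \<open>cofinal\<close>. As
  that notion is strict, this yields only a weak bound, and a larger element makes it
  strict.\<close>

lemma bounded:
  assumes "X \<subseteq> Field r" "|X| <o r"
  shows "\<exists>b \<in> Field r. \<forall>x \<in> X. x \<lhd> b"
proof -
  have "\<not> cofinal X r"
    using assms Reg not_ordLess_ordIso unfolding regularCard_def by blast
  then obtain a where a: "a \<in> Field r" "\<And>b. b \<in> X \<Longrightarrow> \<not> a \<lhd> b"
    unfolding cofinal_def underS_def by blast
  obtain b where b: "a \<lhd> b" using gt_exists a by blast
  have "x \<lhd> b" if "x \<in> X" for x
    using a(2)[OF that] not_lt_iff[OF a(1)] that assms(1) le_lt_trans[OF _ b] by blast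
  then show ?thesis using lt_Field[OF b] by blast
qed

lemma countable_small: "countable X \<Longrightarrow> |X| <o r"
  unfolding countable_card_le_natLeq by (rule ordLeq_ordLess_trans[OF _ natLeq_lt])

lemma bounded_image:
  assumes "|K| <o r" "f ` K \<subseteq> Field r"
  shows "\<exists>b \<in> Field r. \<forall>x \<in> K. f x \<lhd> b"
  using bounded[OF assms(2) ordLeq_ordLess_trans[OF card_of_image assms(1)]] by blast

lemma bounded_countable:
  "countable X \<Longrightarrow> X \<subseteq> Field r \<Longrightarrow> \<exists>b \<in> Field r. \<forall>x \<in> X. x \<lhd> b"
  using bounded countable_small by blast

section \<open>The countable ordinals as an initial segment of \<lambda>\<close>

lemma omega1_in_eq:
  obtains w where "w \<in> Field r" "omega1_in r = underS r w" "|underS r w| =o omega1"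
proof -
  have wo1: "Well_order omega1" using omega1_Card_order unfolding card_order_on_def by blast
  \<comment> \<open>This w is the ordinal \<open>\<omega>\<^sub>1\<close> inside \<lambda>;
    \<open>less\<close> and \<open>ge\<close> compare the order types of the segments below a with
    it, for a < w and for a \<ge> w.\<close>
  obtain w where w: "w \<in> Field r" "omega1 =o Restr r (underS r w)"
    using omega1_lt ordLess_iff_ordIso_Restr[OF wo wo1] by blast
  have F: "Field (Restr r (underS r a)) = underS r a" for a
    using Field_Restr_ofilter[OF wo] wo_rel.underS_ofilter[OF wo_rel] by blast
  have less: "Restr r (underS r a) <o Restr r (underS r w)" if "a \<lhd> w" for a
  proof -
    let ?p = "Restr r (underS r w)"
    have "Restr ?p (underS ?p a) <o ?p"
      using underS_Restr_ordLess[of ?p a] w(2) that F[of w]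
      by (metis Well_order_Restr empty_iff wo)
    moreover have "Restr ?p (underS ?p a) = Restr r (underS r a)"
    proof -
      have "underS ?p a = underS r a"
        using that lt_trans unfolding underS_def by blast
      then show ?thesis using that lt_trans by blast
    qed
    ultimately show ?thesis by simp
  qed
  have ge: "\<not> Restr r (underS r a) <o omega1" if "w \<unlhd> a" for a
  proof
    assume *: "Restr r (underS r a) <o omega1"
    have "Restr r (underS r w) \<le>o Restr r (underS r a)"
      using ofilter_subset_ordLeq[OF wo] wo_rel.underS_ofilter[OF wo_rel] underS_mono[OF that]
      by blast
    then have "omega1 \<le>o Restr r (underS r a)"
      using w(2) ordIso_ordLeq_trans by blast
    then show False using * not_ordLeq_ordLess by blast
  qed
  have "omega1_in r = underS r w"
    unfolding omega1_in_def
    using less ge w not_lt_iff lt_Field ordLess_ordIso_trans ordIso_symmetric by blast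
  moreover have "|underS r w| =o omega1"
    using card_of_cong[OF w(2)] F card_of_Field_ordIso[OF omega1_Card_order]
    using ordIso_symmetric ordIso_transitive by metis
  ultimately show ?thesis using that w by blast
qed

lemma card_omega1_in: "|omega1_in r| =o omega1"
proof -
  obtain w where "omega1_in r = underS r w" "|underS r w| =o omega1"
    by (rule omega1_in_eq)
  then show ?thesis by simp
qed

lemma omega1_in_small: "|omega1_in r| <o r"
  using card_omega1_in omega1_lt ordIso_ordLess_trans by blast

lemma omega1_in_Field: "omega1_in r \<subseteq> Field r"
  by (auto simp: omega1_in_def)

lemma omega1_in_down: "a \<in> omega1_in r \<Longrightarrow> b \<lhd> a \<Longrightarrow> b \<in> omega1_in r"
proof -
  assume *: "a \<in> omega1_in r" "b \<lhd> a"
  obtain w where "omega1_in r = underS r w"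
    by (rule omega1_in_eq)
  then show ?thesis using * lt_trans by blast
qed

lemma uncountable_omega1_in: "uncountable (omega1_in r)"
  using card_omega1_in ordLess_omega1_iff_countable not_ordLess_ordIso by blast

lemma countable_underS_omega1: "a \<in> omega1_in r \<Longrightarrow> countable (underS r a)"
proof -
  assume a: "a \<in> omega1_in r"
  have F: "Field (Restr r (underS r a)) = underS r a"
    using Field_Restr_ofilter[OF wo] wo_rel.underS_ofilter[OF wo_rel] by blast
  have "|underS r a| <o omega1"
    using ordLess_Field[of "Restr r (underS r a)" omega1] a
    unfolding F omega1_in_def by blast
  then show ?thesis by (simp add: ordLess_omega1_iff_countable)
qed

lemma omega1_in_bounded:
  assumes "countable X" "X \<subseteq> omega1_in r"
  shows "\<exists>b \<in> omega1_in r. \<forall>x \<in> X. x \<lhd> b"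
proof (rule ccontr)
  assume "\<not> ?thesis"
  then have *: "\<exists>x \<in> X. b \<unlhd> x" if "b \<in> omega1_in r" for b
    using that assms omega1_in_Field not_lt_iff by blast
  have "omega1_in r \<subseteq> (\<Union>x \<in> X. underS r x \<union> {x})"
    using * le_cases by blast
  moreover have "countable (\<Union>x \<in> X. underS r x \<union> {x})"
    using assms countable_underS_omega1 by (intro countable_UN) auto
  ultimately show False using uncountable_omega1_in countable_subset by blast
qed

lemma upper_bound2: "x \<in> Field r \<Longrightarrow> y \<in> Field r \<Longrightarrow> \<exists>b. x \<lhd> b \<and> y \<lhd> b"
  using bounded_countable[of "{x, y}"] by auto

lemma bounded_below:
  assumes "f ` Field r \<subseteq> Field r" "x \<in> Field r"
  shows "\<exists>b \<in> Field r. x \<lhd> b \<and> (\<forall>\<alpha>. \<alpha> \<unlhd> x \<longrightarrow> f \<alpha> \<lhd> b)"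
proof -
  have "f ` underS r x \<subseteq> Field r" using assms(1) lt_Field by blast
  then obtain b where b: "b \<in> Field r" "\<forall>\<alpha> \<in> underS r x. f \<alpha> \<lhd> b"
    using bounded_image[OF card_of_underS[OF Card assms(2)]] by blast
  obtain c where c: "b \<lhd> c" "f x \<lhd> c"
    using upper_bound2[of b "f x"] b(1) assms by blast
  obtain d where d: "c \<lhd> d" "x \<lhd> d"
    using upper_bound2[of c x] c(1) lt_Field assms(2) by blast
  have "f \<alpha> \<lhd> d" if "\<alpha> \<unlhd> x" for \<alpha>
    using le_cases[OF that] b(2) c d(1) lt_trans by blast
  then show ?thesis using d(2) lt_Field by blast
qed

subsection \<open>Nonstationary sets of points of cofinality \<open>\<omega>\<close>\<close>

text \<open>The sequence need not increase. The strict bound in the second clause excludes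
  successors, and the first clause excludes 0.\<close>

definition cof_omega :: "'a set" where
  "cof_omega = {\<beta>. \<exists>g :: nat \<Rightarrow> 'a. (\<forall>n. g n \<lhd> \<beta>) \<and> (\<forall>\<alpha>. \<alpha> \<lhd> \<beta> \<longrightarrow> (\<exists>n. \<alpha> \<lhd> g n))}"

lemma cof_omega_Field: "\<beta> \<in> cof_omega \<Longrightarrow> \<beta> \<in> Field r"
  unfolding cof_omega_def by (auto dest: lt_Field)

lemma cof_omega_lim_points:
  assumes "\<beta> \<in> cof_omega"
  shows "\<beta> \<in> lim_points r (Field r)"
proof -
  obtain g :: "nat \<Rightarrow> 'a" where g: "\<And>n. g n \<lhd> \<beta>" "\<And>\<alpha>. \<alpha> \<lhd> \<beta> \<Longrightarrow> \<exists>n. \<alpha> \<lhd> g n"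
    using assms unfolding cof_omega_def by blast
  have "g n \<in> Field r \<inter> underS r \<beta>" for n using g(1)[of n] lt_Field[OF g(1)[of n]] by simp
  then show ?thesis
    using g(2) cof_omega_Field[OF assms] unfolding lim_points_def limit_point_def by blast
qed

text \<open>A set is null if its intersection with \<open>cof_omega\<close> is nonstationary in \<open>\<lambda>\<close>: the points
  closed under a function \<open>f : \<lambda> \<rightarrow> \<lambda>\<close> form a club, and every club contains the limit ordinals in such a club.\<close>

definition null :: "'a set \<Rightarrow> bool" where
  "null A \<longleftrightarrow>
     (\<exists>f. f ` Field r \<subseteq> Field r \<and>
        (\<forall>\<beta> \<in> A \<inter> cof_omega. \<not> (\<forall>\<alpha>. \<alpha> \<lhd> \<beta> \<longrightarrow> f \<alpha> \<lhd> \<beta>)))"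

lemma null_mono: "null B \<Longrightarrow> A \<inter> cof_omega \<subseteq> B \<Longrightarrow> null A"
proof -
  assume *: "null B" "A \<inter> cof_omega \<subseteq> B"
  then obtain f where f: "f ` Field r \<subseteq> Field r"
    "\<forall>\<beta> \<in> B \<inter> cof_omega. \<not> (\<forall>\<alpha>. \<alpha> \<lhd> \<beta> \<longrightarrow> f \<alpha> \<lhd> \<beta>)"
    unfolding null_def by auto
  show ?thesis unfolding null_def
  proof (intro exI[of _ f] conjI ballI)
    show "f ` Field r \<subseteq> Field r" by (rule f(1))
    show "\<not> (\<forall>\<alpha>. \<alpha> \<lhd> \<beta> \<longrightarrow> f \<alpha> \<lhd> \<beta>)" if "\<beta> \<in> A \<inter> cof_omega" for \<beta>
      using f(2) that *(2) by auto
  qed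
qed

lemma null_subset: "null B \<Longrightarrow> A \<subseteq> B \<Longrightarrow> null A"
  by (erule null_mono) blast

lemma null_empty: "null {}"
  unfolding null_def by (rule exI[of _ "\<lambda>x. x"]) simp

text \<open>Given f, the supremum of an \<omega>-sequence in which each term bounds f on everything
  up to the preceding term is closed under f and has cofinality \<omega>.\<close>

lemma not_null_Field: "\<not> null (Field r)"
proof
  assume "null (Field r)"
  then obtain f where f: "f ` Field r \<subseteq> Field r"
    and no': "\<forall>\<beta> \<in> Field r \<inter> cof_omega. \<not> (\<forall>\<alpha>. \<alpha> \<lhd> \<beta> \<longrightarrow> f \<alpha> \<lhd> \<beta>)"
    unfolding null_def by auto
  have no: "\<not> (\<forall>\<alpha>. \<alpha> \<lhd> \<beta> \<longrightarrow> f \<alpha> \<lhd> \<beta>)" if "\<beta> \<in> cof_omega" for \<beta>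
    using no' that cof_omega_Field by auto
  obtain g :: "nat \<Rightarrow> 'a" where g: "\<And>n. g n \<in> Field r" "\<And>n. g n \<lhd> g (Suc n)"
    "\<And>n \<alpha>. \<alpha> \<unlhd> g n \<Longrightarrow> f \<alpha> \<lhd> g (Suc n)"
    using dependent_nat_choice[of "\<lambda>_ x. x \<in> Field r"
        "\<lambda>_ x y. x \<lhd> y \<and> (\<forall>\<alpha>. \<alpha> \<unlhd> x \<longrightarrow> f \<alpha> \<lhd> y)"]
      bounded_below[OF f] infinite_Field by (metis ex_in_conv finite.emptyI)
  obtain b where "b \<in> Field r" "\<forall>x \<in> range g. x \<lhd> b"
    using bounded_countable[of "range g"] g(1) by auto
  then obtain \<beta> where \<beta>: "\<beta> \<in> Field r" "\<forall>x \<in> range g. x \<lhd> \<beta>"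
    and least: "\<And>c. c \<lhd> \<beta> \<Longrightarrow> \<not> (\<forall>x \<in> range g. x \<lhd> c)"
    using least_exists[of b "\<lambda>b. \<forall>x \<in> range g. x \<lhd> b"] by metis
  have below: "\<exists>n. \<alpha> \<unlhd> g n" if "\<alpha> \<lhd> \<beta>" for \<alpha>
    using least[OF that] not_lt_iff g(1) lt_Field[OF that] by blast
  have "\<beta> \<in> cof_omega"
    unfolding cof_omega_def using \<beta> below le_lt_trans g(2) by blast
  moreover have "f \<alpha> \<lhd> \<beta>" if "\<alpha> \<lhd> \<beta>" for \<alpha>
    using below[OF that] g(3) \<beta>(2) lt_trans by blast
  ultimately show False using no by blast
qed

text \<open>No point of \<open>cof_omega\<close> up to \<eta> is closed under the constant function
  with value \<eta>.\<close>

lemma null_bounded: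
  assumes "\<eta> \<in> Field r"
  shows "null {\<beta>. \<beta> \<unlhd> \<eta>}"
proof -
  have "\<not> (\<forall>\<alpha>. \<alpha> \<lhd> \<beta> \<longrightarrow> \<eta> \<lhd> \<beta>)" if "\<beta> \<in> cof_omega" "\<beta> \<unlhd> \<eta>" for \<beta>
    using that le_lt_trans lt_irrefl unfolding cof_omega_def by blast
  then show ?thesis
    unfolding null_def using assms by (intro exI[of _ "\<lambda>_. \<eta>"]) auto
qed

text \<open>The ideal is closed under diagonal unions, which is Fodor's lemma in the form needed
  here. The witness h bounds, at x, all values \<open>f \<theta> \<alpha>\<close> with \<theta> and
  \<alpha> up to x.\<close>

lemma null_diag:
  assumes "\<And>\<theta>. \<theta> \<in> Field r \<Longrightarrow> null {\<beta> \<in> A. P \<theta> \<beta>}"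
  shows "null {\<beta> \<in> A. \<exists>\<theta>. \<theta> \<lhd> \<beta> \<and> P \<theta> \<beta>}"
proof -
  obtain f where f: "\<And>\<theta>. \<theta> \<in> Field r \<Longrightarrow> f \<theta> ` Field r \<subseteq> Field r"
    and no: "\<And>\<theta> \<beta>. \<theta> \<in> Field r \<Longrightarrow> \<beta> \<in> A \<Longrightarrow> P \<theta> \<beta> \<Longrightarrow> \<beta> \<in> cof_omega \<Longrightarrow>
      \<exists>\<alpha>. \<alpha> \<lhd> \<beta> \<and> \<not> f \<theta> \<alpha> \<lhd> \<beta>"
    using assms unfolding null_def by (simp add: Ball_def) metis
  obtain e where e: "\<And>\<theta> x. \<theta> \<in> Field r \<Longrightarrow> x \<in> Field r \<Longrightarrow> e \<theta> x \<in> Field r"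
    "\<And>\<theta> x \<alpha>. \<theta> \<in> Field r \<Longrightarrow> x \<in> Field r \<Longrightarrow> \<alpha> \<unlhd> x \<Longrightarrow> f \<theta> \<alpha> \<lhd> e \<theta> x"
    using bounded_below[OF f] by metis
  have "\<exists>b \<in> Field r. \<forall>\<theta>. \<theta> \<unlhd> x \<longrightarrow> e \<theta> x \<lhd> b" if "x \<in> Field r" for x
    using bounded_below[of "\<lambda>\<theta>. e \<theta> x" x] e(1) that by blast
  then obtain h where h: "\<And>x. x \<in> Field r \<Longrightarrow> h x \<in> Field r"
    "\<And>x \<theta>. x \<in> Field r \<Longrightarrow> \<theta> \<unlhd> x \<Longrightarrow> e \<theta> x \<lhd> h x"
    by metis
  have "\<exists>\<alpha>. \<alpha> \<lhd> \<beta> \<and> \<not> h \<alpha> \<lhd> \<beta>"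
    if \<beta>: "\<beta> \<in> A" "\<theta> \<lhd> \<beta>" "P \<theta> \<beta>" "\<beta> \<in> cof_omega" for \<beta> \<theta>
  proof -
    have \<theta>: "\<theta> \<in> Field r" using \<beta>(2) lt_Field by blast
    obtain \<alpha> where \<alpha>: "\<alpha> \<lhd> \<beta>" "\<not> f \<theta> \<alpha> \<lhd> \<beta>" using no[OF \<theta>] \<beta> by blast
    \<comment> \<open>The larger of \<theta> and \<alpha> will do.\<close>
    obtain m where m: "m \<lhd> \<beta>" "\<theta> \<unlhd> m" "\<alpha> \<unlhd> m"
      using \<alpha> \<beta>(2) \<theta> lt_Field not_lt_iff lt_imp_le by (metis le_refl)
    have mF: "m \<in> Field r" using m lt_Field by blast
    have "f \<theta> \<alpha> \<lhd> h m"
      using lt_trans[OF e(2)[OF \<theta> mF m(3)] h(2)[OF mF m(2)]] .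
    then show ?thesis using m(1) \<alpha>(2) lt_trans by blast
  qed
  then show ?thesis unfolding null_def using h(1) by (intro exI[of _ h]) blast
qed

lemma null_Un:
  assumes "null A" "null B"
  shows "null (A \<union> B)"
proof -
  obtain f where f: "f ` Field r \<subseteq> Field r" "\<forall>\<beta> \<in> A \<inter> cof_omega. \<not> (\<forall>\<alpha>. \<alpha> \<lhd> \<beta> \<longrightarrow> f \<alpha> \<lhd> \<beta>)"
    using assms(1) unfolding null_def by auto
  obtain g where g: "g ` Field r \<subseteq> Field r" "\<forall>\<beta> \<in> B \<inter> cof_omega. \<not> (\<forall>\<alpha>. \<alpha> \<lhd> \<beta> \<longrightarrow> g \<alpha> \<lhd> \<beta>)"
    using assms(2) unfolding null_def by auto
  have "\<exists>b. f x \<lhd> b \<and> g x \<lhd> b" if "x \<in> Field r" for x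
    using upper_bound2 f(1) g(1) that by blast
  then obtain h where h: "\<And>x. x \<in> Field r \<Longrightarrow> f x \<lhd> h x \<and> g x \<lhd> h x" by metis
  have "\<not> (\<forall>\<alpha>. \<alpha> \<lhd> \<beta> \<longrightarrow> h \<alpha> \<lhd> \<beta>)" if "\<beta> \<in> (A \<union> B) \<inter> cof_omega" for \<beta>
    using that f(2) g(2) h lt_Field lt_trans by (metis IntE IntI UnE)
  then show ?thesis unfolding null_def using h lt_Field by blast
qed

lemma not_null_point_above:
  assumes "\<not> null A" "\<eta> \<in> Field r"
  obtains \<beta> where "\<beta> \<in> A" "\<beta> \<in> cof_omega" "\<eta> \<lhd> \<beta>"
proof -
  have "\<not> A \<inter> cof_omega \<subseteq> {\<beta>. \<beta> \<unlhd> \<eta>}"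
    using null_mono[OF null_bounded[OF assms(2)]] assms(1) by blast
  then show ?thesis using that not_lt_iff assms(2) cof_omega_Field by blast
qed

end

subsection \<open>Initial segments of a square sequence\<close>

locale square_sequence = regular_order r for r :: "'a rel" +
  fixes C :: "'a \<Rightarrow> 'a set"
  assumes club: "\<And>\<alpha>. \<alpha> \<in> lim_points r (Field r) \<Longrightarrow> club_in r (underS r \<alpha>) (C \<alpha>)"
    and coherent: "\<And>\<alpha> \<beta>. \<beta> \<in> lim_points r (Field r) \<Longrightarrow> \<alpha> \<in> lim_points r (C \<beta>) \<Longrightarrow>
      C \<alpha> = C \<beta> \<inter> underS r \<alpha>"
    and no_thread: "\<not> (\<exists>D. club_in r (Field r) D \<and>
      (\<forall>\<alpha> \<in> lim_points r D. D \<inter> underS r \<alpha> = C \<alpha>))"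
begin

lemma C_limit_point:
  assumes "\<beta> \<in> lim_points r (Field r)" "\<alpha> \<lhd> \<beta>" "limit_point r (C \<beta>) \<alpha>"
  shows "\<alpha> \<in> C \<beta>" "C \<alpha> = C \<beta> \<inter> underS r \<alpha>"
proof -
  show "\<alpha> \<in> C \<beta>" using club[OF assms(1)] assms unfolding club_in_def by blast
  then show "C \<alpha> = C \<beta> \<inter> underS r \<alpha>"
    using coherent[OF assms(1)] assms(3) unfolding lim_points_def by blast
qed

text \<open>A non-null set cannot be split into null pieces according to \<open>C \<beta> \<inter> \<eta>\<close>: if \<open>\<eta>\<close> is a
  limit point of \<open>C \<beta>\<close>, coherence determines \<open>C \<beta> \<inter> \<eta>\<close>, and otherwise it is determined by
  \<open>C \<beta> \<inter> \<eta>'\<close> for some \<open>\<eta>' < \<eta>\<close>, up to the element \<open>\<eta>'\<close>. So there are fewer than \<open>\<lambda>\<close> cases.\<close>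

lemma trace_not_null:
  assumes "\<eta> \<in> Field r" "\<not> null A"
  shows "\<exists>c. \<not> null {\<beta> \<in> A. C \<beta> \<inter> underS r \<eta> = c}"
  using assms
proof (induction \<eta> arbitrary: A rule: lt_induct)
  case (less \<eta>)
  show ?case
  proof (rule ccontr)
    assume contra: "\<not> ?case"
    \<comment> \<open>An \<eta>' bounding the part of \<open>C \<beta>\<close> below \<eta> may or
      may not belong to \<open>C \<beta>\<close>: Q is the case that it does, P the case that it
      does not.\<close>
    define P where "P \<eta>' \<beta> \<longleftrightarrow> \<eta>' \<lhd> \<eta> \<and> C \<beta> \<inter> underS r \<eta> = C \<beta> \<inter> underS r \<eta>'" for \<eta>' \<beta>
    define Q where "Q \<eta>' \<beta> \<longleftrightarrow> \<eta>' \<lhd> \<eta> \<and> C \<beta> \<inter> underS r \<eta> = insert \<eta>' (C \<beta> \<inter> underS r \<eta>')"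
      for \<eta>' \<beta>
    have P: "null {\<beta> \<in> A. P \<eta>' \<beta>}" for \<eta>'
    proof (rule ccontr)
      assume *: "\<not> ?thesis"
      have l: "\<eta>' \<lhd> \<eta>"
      proof (rule ccontr)
        assume "\<not> \<eta>' \<lhd> \<eta>"
        then have "{\<beta> \<in> A. P \<eta>' \<beta>} = {}" unfolding P_def by blast
        then show False using * null_empty by (simp only: not_True_eq_False)
      qed
      obtain c where "\<not> null {\<beta> \<in> {\<beta> \<in> A. P \<eta>' \<beta>}. C \<beta> \<inter> underS r \<eta>' = c}"
        using less.IH[OF l *] by blast
      moreover have "{\<beta> \<in> {\<beta> \<in> A. P \<eta>' \<beta>}. C \<beta> \<inter> underS r \<eta>' = c} \<subseteq> {\<beta> \<in> A. C \<beta> \<inter> underS r \<eta> = c}"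
        unfolding P_def by blast
      ultimately show False using contra null_subset by blast
    qed
    have Q: "null {\<beta> \<in> A. Q \<eta>' \<beta>}" for \<eta>'
    proof (rule ccontr)
      assume *: "\<not> ?thesis"
      have l: "\<eta>' \<lhd> \<eta>"
      proof (rule ccontr)
        assume "\<not> \<eta>' \<lhd> \<eta>"
        then have "{\<beta> \<in> A. Q \<eta>' \<beta>} = {}" unfolding Q_def by blast
        then show False using * null_empty by (simp only: not_True_eq_False)
      qed
      obtain c where "\<not> null {\<beta> \<in> {\<beta> \<in> A. Q \<eta>' \<beta>}. C \<beta> \<inter> underS r \<eta>' = c}"
        using less.IH[OF l *] by blast
      moreover have "{\<beta> \<in> {\<beta> \<in> A. Q \<eta>' \<beta>}. C \<beta> \<inter> underS r \<eta>' = c} \<subseteq>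
          {\<beta> \<in> A. C \<beta> \<inter> underS r \<eta> = insert \<eta>' c}"
        unfolding Q_def by blast
      ultimately show False using contra null_subset by blast
    qed
    \<comment> \<open>In the case that matters \<eta>' < \<eta> < \<beta>, so one diagonal union
      absorbs all \<eta>' at once.\<close>
    have PQ: "null {\<beta> \<in> A. \<exists>\<eta>'. \<eta>' \<lhd> \<beta> \<and> (P \<eta>' \<beta> \<or> Q \<eta>' \<beta>)}"
    proof (rule null_diag)
      fix \<eta>'
      have "{\<beta> \<in> A. P \<eta>' \<beta> \<or> Q \<eta>' \<beta>} = {\<beta> \<in> A. P \<eta>' \<beta>} \<union> {\<beta> \<in> A. Q \<eta>' \<beta>}" by blast
      then show "null {\<beta> \<in> A. P \<eta>' \<beta> \<or> Q \<eta>' \<beta>}" using null_Un[OF P Q] by simp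
    qed
    \<comment> \<open>Every \<beta> in A of cofinality \<omega> falls into one of four null cases:
      it is at most \<eta>; its trace is empty (if \<eta> = 0); its trace is \<open>C \<eta>\<close>
      (if \<eta> is a limit point of \<open>C \<beta>\<close>); or some \<eta>' < \<eta> determines
      the trace as in P or Q.\<close>
    let ?X = "{\<beta>. \<beta> \<unlhd> \<eta>} \<union> {\<beta> \<in> A. C \<beta> \<inter> underS r \<eta> = {}} \<union> {\<beta> \<in> A. C \<beta> \<inter> underS r \<eta> = C \<eta>}
      \<union> {\<beta> \<in> A. \<exists>\<eta>'. \<eta>' \<lhd> \<beta> \<and> (P \<eta>' \<beta> \<or> Q \<eta>' \<beta>)}"
    have "null ?X"
      using contra null_bounded[OF less.hyps] PQ by (intro null_Un) blast+
    moreover have "A \<inter> cof_omega \<subseteq> ?X"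
    proof
      fix \<beta> assume \<beta>: "\<beta> \<in> A \<inter> cof_omega"
      have lim: "\<beta> \<in> lim_points r (Field r)" using \<beta> cof_omega_lim_points by blast
      show "\<beta> \<in> ?X"
      proof (cases "\<eta> \<lhd> \<beta> \<and> underS r \<eta> \<noteq> {} \<and> \<not> limit_point r (C \<beta>) \<eta>")
        case True
        then obtain \<eta>' where \<eta>': "\<eta>' \<lhd> \<eta>" "\<And>\<gamma>. \<gamma> \<in> C \<beta> \<Longrightarrow> \<gamma> \<lhd> \<eta> \<Longrightarrow> \<not> \<eta>' \<lhd> \<gamma>"
          using less.hyps unfolding limit_point_def by blast
        have le: "\<gamma> \<lhd> \<eta>' \<or> \<gamma> = \<eta>'" if "\<gamma> \<in> C \<beta>" "\<gamma> \<lhd> \<eta>" for \<gamma>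
          using \<eta>'(2)[OF that] not_lt_iff le_cases lt_Field that(2) \<eta>'(1) by blast
        have "P \<eta>' \<beta> \<or> Q \<eta>' \<beta>"
        proof (cases "\<eta>' \<in> C \<beta>")
          case True
          then have "Q \<eta>' \<beta>" unfolding Q_def using \<eta>'(1) le lt_trans by blast
          then show ?thesis ..
        next
          case False
          then have "P \<eta>' \<beta>" unfolding P_def using \<eta>'(1) le lt_trans by blast
          then show ?thesis ..
        qed
        then show ?thesis using \<beta> True \<eta>'(1) lt_trans by blast
      next
        case False
        then consider "\<beta> \<unlhd> \<eta>" | "underS r \<eta> = {}" | "\<eta> \<lhd> \<beta>" "limit_point r (C \<beta>) \<eta>"
          using not_lt_iff less.hyps \<beta> cof_omega_Field by blast
        then show ?thesis using C_limit_point(2)[OF lim, of \<eta>] \<beta> by cases auto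
      qed
    qed
    ultimately show False using less.prems null_mono by blast
  qed
qed

text \<open>If no \<theta> splits B, let D consist of the \<theta> that lie in
  \<open>C \<beta>\<close> for almost all \<beta> in B. By \<open>null_diag\<close>, almost every
  \<beta> in B satisfies \<open>C \<beta> = D \<inter> underS r \<beta>\<close>, so coherence makes
  D a thread.\<close>

lemma splitting:
  assumes B: "\<not> null B"
  shows "\<exists>\<theta> \<in> Field r. \<not> null {\<beta> \<in> B. \<theta> \<in> C \<beta>} \<and> \<not> null {\<beta> \<in> B. \<theta> \<notin> C \<beta>}"
proof (rule ccontr)
  assume contra: "\<not> ?thesis"
  define D where "D = {\<theta> \<in> Field r. null {\<beta> \<in> B. \<theta> \<notin> C \<beta>}}"
  have N: "null {\<beta> \<in> B. \<exists>\<theta>. \<theta> \<lhd> \<beta> \<and> (\<theta> \<in> C \<beta>) \<noteq> (\<theta> \<in> D)}"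
  proof (rule null_diag)
    fix \<theta> assume \<theta>: "\<theta> \<in> Field r"
    show "null {\<beta> \<in> B. (\<theta> \<in> C \<beta>) \<noteq> (\<theta> \<in> D)}"
      using contra \<theta> by (cases "\<theta> \<in> D") (auto simp: D_def)
  qed
  have main: "\<exists>\<beta>. \<alpha> \<lhd> \<beta> \<and> \<beta> \<in> lim_points r (Field r) \<and> C \<beta> = D \<inter> underS r \<beta>"
    if \<alpha>: "\<alpha> \<in> Field r" for \<alpha>
  proof -
    let ?N = "{\<beta> \<in> B. \<exists>\<theta>. \<theta> \<lhd> \<beta> \<and> (\<theta> \<in> C \<beta>) \<noteq> (\<theta> \<in> D)}"
    have "\<not> null (B - ?N)" using null_Un[OF _ N, of "B - ?N"] null_subset B by blast
    then obtain \<beta> where \<beta>: "\<beta> \<in> B - ?N" "\<beta> \<in> cof_omega" "\<alpha> \<lhd> \<beta>"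
      using not_null_point_above \<alpha> by blast
    have lim: "\<beta> \<in> lim_points r (Field r)" using \<beta>(2) cof_omega_lim_points by blast
    then have "C \<beta> \<subseteq> underS r \<beta>" using club unfolding club_in_def by blast
    then show ?thesis using \<beta> lim by blast
  qed
  have transfer: "limit_point r (C \<beta>) \<alpha>"
    if "\<alpha> \<lhd> \<beta>" "C \<beta> = D \<inter> underS r \<beta>" "limit_point r D \<alpha>" for \<alpha> \<beta>
    using that lt_trans unfolding limit_point_def by blast
  have "club_in r (Field r) D"
    unfolding club_in_def
  proof (intro conjI ballI impI)
    show "D \<subseteq> Field r" unfolding D_def by blast
    show "\<exists>\<gamma> \<in> D. \<alpha> \<unlhd> \<gamma>" if \<alpha>: "\<alpha> \<in> Field r" for \<alpha>
      using main[OF \<alpha>] club unfolding club_in_def by blast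
    show "\<delta> \<in> D" if \<delta>: "\<delta> \<in> Field r" "limit_point r D \<delta>" for \<delta>
      using main[OF \<delta>(1)] transfer \<delta>(2) C_limit_point(1) by blast
  qed
  moreover have "D \<inter> underS r \<alpha> = C \<alpha>" if \<alpha>: "\<alpha> \<in> lim_points r D" for \<alpha>
  proof -
    have lp: "\<alpha> \<in> Field r" "limit_point r D \<alpha>"
      using \<alpha> unfolding lim_points_def limit_point_def by auto
    obtain \<beta> where \<beta>: "\<alpha> \<lhd> \<beta>" "\<beta> \<in> lim_points r (Field r)" "C \<beta> = D \<inter> underS r \<beta>"
      using main[OF lp(1)] by blast
    have "C \<alpha> = C \<beta> \<inter> underS r \<alpha>"
      using C_limit_point(2) transfer \<beta> lp(2) by blast
    then show ?thesis using \<beta> lt_trans by blast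
  qed
  ultimately show False using no_thread by blast
qed

text \<open>Values taken only on a null set are discarded. What remains is a tree in which every
  node extends to every higher level.\<close>

definition traces :: "'a \<Rightarrow> 'a set set" where
  "traces \<eta> = {c. \<not> null {\<beta> \<in> Field r. C \<beta> \<inter> underS r \<eta> = c}}"

lemma traces_extend:
  assumes "\<not> null A" "A \<subseteq> Field r" "\<delta> \<in> Field r"
  shows "\<exists>c \<in> traces \<delta>. \<exists>\<beta> \<in> A. C \<beta> \<inter> underS r \<delta> = c"
proof -
  obtain c where c: "\<not> null {\<beta> \<in> A. C \<beta> \<inter> underS r \<delta> = c}"
    using trace_not_null[OF assms(3,1)] by blast
  have "{\<beta> \<in> A. C \<beta> \<inter> underS r \<delta> = c} \<subseteq> {\<beta> \<in> Field r. C \<beta> \<inter> underS r \<delta> = c}"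
    using assms(2) by auto
  then have "c \<in> traces \<delta>"
    unfolding traces_def using null_subset c by blast
  moreover have "{\<beta> \<in> A. C \<beta> \<inter> underS r \<delta> = c} \<noteq> {}"
    using c null_empty by metis
  ultimately show ?thesis by blast
qed

text \<open>If all the sets \<open>traces \<delta>\<close> were countable, then each \<open>\<delta>\<close> would have only countably many
  ordinals at which two elements of \<open>traces \<delta>\<close> first differ. These sets of ordinals increase
  with \<open>\<delta>\<close>, and by the splitting property their union is unbounded in \<open>\<lambda>\<close>; as \<open>\<lambda> > \<omega>\<^sub>1\<close> is
  regular, \<open>\<omega>\<^sub>1\<close> elements of the union already appear at some \<open>\<delta>\<close>.\<close>

lemma uncountable_traces: "\<exists>\<eta> \<in> Field r. uncountable (traces \<eta>)"
proof (rule ccontr)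
  assume "\<not> ?thesis"
  then have ctble: "countable (traces \<delta>)" if "\<delta> \<in> Field r" for \<delta> using that by blast
  define dif where "dif c d \<theta> \<longleftrightarrow> c \<inter> underS r \<theta> = d \<inter> underS r \<theta> \<and> (\<theta> \<in> c) \<noteq> (\<theta> \<in> d)"
    for c d :: "'a set" and \<theta>
  define K where "K \<delta> = {\<theta>. \<theta> \<lhd> \<delta> \<and> (\<exists>c \<in> traces \<delta>. \<exists>d \<in> traces \<delta>. dif c d \<theta>)}" for \<delta>
  have K_countable: "countable (K \<delta>)" if "\<delta> \<in> Field r" for \<delta>
  proof -
    have "\<forall>\<theta> \<in> K \<delta>. \<exists>p. p \<in> traces \<delta> \<times> traces \<delta> \<and> dif (fst p) (snd p) \<theta>"
      unfolding K_def by auto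
    then obtain p where
      "\<forall>\<theta> \<in> K \<delta>. p \<theta> \<in> traces \<delta> \<times> traces \<delta> \<and> dif (fst (p \<theta>)) (snd (p \<theta>)) \<theta>"
      by (rule bchoice[THEN exE])
    then have p: "\<And>\<theta>. \<theta> \<in> K \<delta> \<Longrightarrow> p \<theta> \<in> traces \<delta> \<times> traces \<delta>"
      "\<And>\<theta>. \<theta> \<in> K \<delta> \<Longrightarrow> dif (fst (p \<theta>)) (snd (p \<theta>)) \<theta>"
      by simp_all
    have KF: "K \<delta> \<subseteq> Field r" unfolding K_def using lt_Field by blast
    have uniq: "\<not> \<theta> \<lhd> \<theta>'" if "dif c d \<theta>" "dif c d \<theta>'" for c d \<theta> \<theta>'
      using that unfolding dif_def by blast
    \<comment> \<open>Two sets have at most one first difference, so \<open>K \<delta>\<close>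
      injects into the countable set of pairs of traces.\<close>
    have "inj_on p (K \<delta>)"
    proof (rule inj_onI)
      fix \<theta> \<theta>' assume *: "\<theta> \<in> K \<delta>" "\<theta>' \<in> K \<delta>" "p \<theta> = p \<theta>'"
      then have "\<not> \<theta> \<lhd> \<theta>'" "\<not> \<theta>' \<lhd> \<theta>"
        using p(2)[of \<theta>] p(2)[of \<theta>'] uniq by metis+
      then show "\<theta> = \<theta>'" using * KF not_lt_iff le_antisym by blast
    qed
    moreover have "countable (p ` K \<delta>)"
      by (rule countable_subset[OF _ countable_SIGMA[OF ctble[OF that] ctble[OF that]]])
        (use p(1) in blast)
    ultimately show ?thesis using countable_image_inj_on by blast
  qed
  have extend: "\<exists>c' \<in> traces \<delta>'. c' \<inter> underS r \<delta> = c" if "c \<in> traces \<delta>" "\<delta> \<unlhd> \<delta>'" for c \<delta> \<delta>'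
  proof -
    let ?A = "{\<beta> \<in> Field r. C \<beta> \<inter> underS r \<delta> = c}"
    have A: "\<not> null ?A" "?A \<subseteq> Field r" using that(1) unfolding traces_def by auto
    have \<delta>': "\<delta>' \<in> Field r" using le_Field[OF that(2)] by blast
    obtain c' \<beta> where c': "c' \<in> traces \<delta>'" "\<beta> \<in> ?A" "C \<beta> \<inter> underS r \<delta>' = c'"
      using traces_extend[OF A \<delta>'] by blast
    then have "c' \<inter> underS r \<delta> = c" using underS_mono[OF that(2)] by auto
    then show ?thesis using c'(1) by blast
  qed
  have K_mono: "K \<delta> \<subseteq> K \<delta>'" if \<delta>: "\<delta> \<unlhd> \<delta>'" for \<delta> \<delta>'
  proof
    fix \<theta> assume "\<theta> \<in> K \<delta>"
    then obtain c d where cd: "\<theta> \<lhd> \<delta>" "c \<in> traces \<delta>" "d \<in> traces \<delta>" "dif c d \<theta>"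
      unfolding K_def by blast
    obtain c' where c': "c' \<in> traces \<delta>'" "c' \<inter> underS r \<delta> = c" using extend[OF cd(2) \<delta>] by blast
    obtain d' where d': "d' \<in> traces \<delta>'" "d' \<inter> underS r \<delta> = d" using extend[OF cd(3) \<delta>] by blast
    have "dif c' d' \<theta>"
      using cd(4) c'(2) d'(2) underS_mono[OF lt_imp_le[OF cd(1)]] cd(1) unfolding dif_def by blast
    then show "\<theta> \<in> K \<delta>'" unfolding K_def using c' d' lt_le_trans[OF cd(1) \<delta>] by blast
  qed
  have unbounded: "\<exists>\<delta> \<in> Field r. \<exists>\<theta> \<in> K \<delta>. \<alpha> \<unlhd> \<theta>" if \<alpha>: "\<alpha> \<in> Field r" for \<alpha>
  proof -
    obtain c0 where c0: "c0 \<in> traces \<alpha>"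
      using traces_extend[OF not_null_Field order_refl \<alpha>] by blast
    let ?B = "{\<beta> \<in> Field r. C \<beta> \<inter> underS r \<alpha> = c0}"
    \<comment> \<open>Splitting the \<beta> with trace c0 gives two traces at \<delta> that agree
      below \<alpha> but disagree at \<theta>0. Their first difference therefore lies between
      \<alpha> and \<theta>0.\<close>
    obtain \<theta>0 where \<theta>0: "\<theta>0 \<in> Field r" "\<not> null {\<beta> \<in> ?B. \<theta>0 \<in> C \<beta>}" "\<not> null {\<beta> \<in> ?B. \<theta>0 \<notin> C \<beta>}"
      using splitting[of ?B] c0 unfolding traces_def by blast
    obtain \<delta> where \<delta>: "\<theta>0 \<lhd> \<delta>" "\<alpha> \<lhd> \<delta>" using upper_bound2 \<theta>0(1) \<alpha> by blast
    have \<delta>F: "\<delta> \<in> Field r" using \<delta> lt_Field by blast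
    obtain c \<beta> where c: "c \<in> traces \<delta>" "\<beta> \<in> ?B" "\<theta>0 \<in> C \<beta>" "C \<beta> \<inter> underS r \<delta> = c"
      using traces_extend[OF \<theta>0(2) _ \<delta>F] by blast
    obtain d \<beta>' where d: "d \<in> traces \<delta>" "\<beta>' \<in> ?B" "\<theta>0 \<notin> C \<beta>'" "C \<beta>' \<inter> underS r \<delta> = d"
      using traces_extend[OF \<theta>0(3) _ \<delta>F] by blast
    have "(\<theta>0 \<in> c) \<noteq> (\<theta>0 \<in> d)" using c d \<delta>(1) by blast
    then obtain \<theta> where \<theta>: "\<theta> \<in> Field r" "(\<theta> \<in> c) \<noteq> (\<theta> \<in> d)"
      "\<And>x. x \<lhd> \<theta> \<Longrightarrow> \<not> ((x \<in> c) \<noteq> (x \<in> d))" "\<theta> \<unlhd> \<theta>0"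
      using least_exists[of \<theta>0 "\<lambda>x. (x \<in> c) \<noteq> (x \<in> d)"] \<theta>0(1) by blast
    have "\<theta> \<in> K \<delta>"
      unfolding K_def dif_def using \<theta> le_lt_trans[OF \<theta>(4) \<delta>(1)] c(1) d(1) by blast
    moreover have "\<not> \<theta> \<lhd> \<alpha>"
    proof
      assume l: "\<theta> \<lhd> \<alpha>"
      then have "\<theta> \<lhd> \<delta>" using \<delta>(2) lt_trans by blast
      then show False using l \<theta>(2) c(2,4) d(2,4) by blast
    qed
    ultimately show ?thesis using \<delta>F not_lt_iff \<theta>(1) \<alpha> by blast
  qed
  let ?K = "\<Union>\<delta> \<in> Field r. K \<delta>"
  have "uncountable ?K"
  proof
    assume "countable ?K"
    moreover have "?K \<subseteq> Field r" unfolding K_def using lt_Field by blast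
    ultimately obtain b where b: "b \<in> Field r" "\<forall>x \<in> ?K. x \<lhd> b" using bounded_countable by blast
    then show False using unbounded[OF b(1)] le_lt_trans lt_irrefl by blast
  qed
  then have "omega1 \<le>o |?K|" by (simp add: uncountable_iff_omega1_ordLeq)
  then have "|Field omega1| \<le>o |?K|"
    using card_of_Field_ordIso[OF omega1_Card_order] ordIso_ordLeq_trans by blast
  then obtain K' where K': "K' \<subseteq> ?K" "|Field omega1| =o |K'|"
    using internalize_card_of_ordLeq2[of "Field omega1" ?K] by blast
  have K'_card: "|K'| =o omega1"
    using K'(2) card_of_Field_ordIso[OF omega1_Card_order] ordIso_symmetric ordIso_transitive by blast
  obtain d where d: "\<And>\<theta>. \<theta> \<in> K' \<Longrightarrow> d \<theta> \<in> Field r \<and> \<theta> \<in> K (d \<theta>)"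
    using K'(1) by (metis UN_E subsetD)
  obtain b where b: "b \<in> Field r" "\<forall>\<theta> \<in> K'. d \<theta> \<lhd> b"
    using bounded_image[OF ordIso_ordLess_trans[OF K'_card omega1_lt], of d] d by blast
  have "K' \<subseteq> K b" using b d K_mono lt_imp_le by blast
  then have "countable K'" using K_countable[OF b(1)] countable_subset by blast
  then show False using K'_card ordLess_omega1_iff_countable not_ordLess_ordIso by blast
qed

end

subsection \<open>Closed sets with prescribed trace on \<open>\<omega>\<^sub>1\<close>\<close>

lemma finite_subset_increasing_Union:
  fixes X :: "nat \<Rightarrow> 'b set"
  assumes "finite e" "e \<subseteq> (\<Union>n. X n)" "\<And>n. X n \<subseteq> X (Suc n)"
  shows "\<exists>n. e \<subseteq> X n"
  using assms(1,2)
proof (induction e)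
  case empty
  then show ?case by blast
next
  case (insert x e)
  then obtain m n where mn: "x \<in> X m" "e \<subseteq> X n" by blast
  have "X k \<subseteq> X l" if "k \<le> l" for k l using lift_Suc_mono_le[of X, OF assms(3) that] .
  then have "insert x e \<subseteq> X (max m n)" using mn by (meson insert_subset max.cobounded1 max.cobounded2 subsetD subset_trans)
  then show ?case by blast
qed

text \<open>The closure clause of \<open>club_small\<close> speaks of sequences indexed by proper
  initial segments of \<open>omega1\<close>. The sequence f is moved to the segment of order type
  \<omega> along an isomorphism.\<close>

lemma club_small_Union_seq:
  fixes f :: "nat \<Rightarrow> 'a set"
  assumes club: "club_small omega1 A \<C>" and f: "\<And>n. f n \<in> \<C>" "\<And>n. f n \<subseteq> f (Suc n)"
  shows "(\<Union>n. f n) \<in> \<C>"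
proof -
  have wo1: "Well_order omega1" using omega1_Card_order unfolding card_order_on_def by (rule conjunct1)
  have "natLeq <o omega1"
    unfolding omega1_def by (rule cardSuc_greater[OF natLeq_Card_order])
  then obtain \<xi> where \<xi>: "\<xi> \<in> Field omega1" "natLeq =o Restr omega1 (underS omega1 \<xi>)"
    using ordLess_iff_ordIso_Restr[OF wo1 natLeq_Well_order] by blast
  then obtain h where h: "iso natLeq (Restr omega1 (underS omega1 \<xi>)) h"
    unfolding ordIso_def by auto
  have F: "Field (Restr omega1 (underS omega1 \<xi>)) = underS omega1 \<xi>"
    by (rule Field_Restr_ofilter[OF wo1 wo_rel.underS_ofilter]) (simp add: wo_rel_def wo1)
  have bij: "bij_betw h UNIV (underS omega1 \<xi>)"
    and le: "\<And>m n. m \<le> n \<longleftrightarrow> (h m, h n) \<in> Restr omega1 (underS omega1 \<xi>)"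
    using h unfolding iso_iff2 F Field_natLeq by (auto simp: natLeq_def)
  define k where "k = inv_into UNIV h"
  have hk: "h (k i) = i" if "i \<in> underS omega1 \<xi>" for i
    unfolding k_def using bij that by (simp add: bij_betw_def f_inv_into_f)
  have kh: "k (h n) = n" for n
    unfolding k_def using bij by (simp add: bij_betw_def)
  have hin: "h n \<in> underS omega1 \<xi>" for n using bij by (auto simp: bij_betw_def)
  have mono: "f (k i) \<subseteq> f (k j)"
    if "i \<in> underS omega1 \<xi>" "j \<in> underS omega1 \<xi>" "(i, j) \<in> omega1" for i j
  proof -
    have "k i \<le> k j" using le[of "k i" "k j"] hk that by simp
    then show ?thesis using lift_Suc_mono_le[of f, OF f(2)] by blast
  qed
  have "(\<Union>i \<in> underS omega1 \<xi>. f (k i)) \<in> \<C>"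
  proof -
    have "\<forall>\<xi> \<in> Field omega1. \<forall>f. underS omega1 \<xi> \<noteq> {} \<longrightarrow> (\<forall>i \<in> underS omega1 \<xi>. f i \<in> \<C>) \<longrightarrow>
        (\<forall>i \<in> underS omega1 \<xi>. \<forall>j \<in> underS omega1 \<xi>. (i, j) \<in> omega1 \<longrightarrow> f i \<subseteq> f j) \<longrightarrow>
        (\<Union>i \<in> underS omega1 \<xi>. f i) \<in> \<C>"
      using club unfolding club_small_def by (elim conjE)
    from this[THEN bspec, OF \<xi>(1), THEN spec, of "\<lambda>i. f (k i)"] show ?thesis
    proof (elim impE)
      show "underS omega1 \<xi> \<noteq> {}" using hin[of 0] by blast
      show "\<forall>i \<in> underS omega1 \<xi>. f (k i) \<in> \<C>" using f(1) by blast
      show "\<forall>i \<in> underS omega1 \<xi>. \<forall>j \<in> underS omega1 \<xi>. (i, j) \<in> omega1 \<longrightarrow> f (k i) \<subseteq> f (k j)"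
        by (intro ballI impI mono)
    qed
  qed
  moreover have "(\<Union>i \<in> underS omega1 \<xi>. f (k i)) = (\<Union>n. f n)"
  proof
    show "(\<Union>i \<in> underS omega1 \<xi>. f (k i)) \<subseteq> (\<Union>n. f n)" by (rule UN_least) (rule UN_upper[OF UNIV_I])
    show "(\<Union>n. f n) \<subseteq> (\<Union>i \<in> underS omega1 \<xi>. f (k i))"
    proof (rule UN_least)
      fix n
      have "f (k (h n)) \<subseteq> (\<Union>i \<in> underS omega1 \<xi>. f (k i))" by (rule UN_upper[OF hin])
      then show "f n \<subseteq> (\<Union>i \<in> underS omega1 \<xi>. f (k i))" by (simp only: kh)
    qed
  qed
  ultimately show ?thesis by simp
qed

lemma club_small_subset: "club_small omega1 A \<C> \<Longrightarrow> y \<in> \<C> \<Longrightarrow> y \<subseteq> A \<and> countable y"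
  unfolding club_small_def small_subsets_omega1 by auto

lemma club_small_cofinal:
  "club_small omega1 A \<C> \<Longrightarrow> x \<subseteq> A \<Longrightarrow> countable x \<Longrightarrow> \<exists>y \<in> \<C>. x \<subseteq> y"
  unfolding club_small_def small_subsets_omega1 by auto

text \<open>By recursion on finite e, choose \<open>F e\<close> in the club above e and above all
  \<open>F e'\<close> with e' a proper subset of e. Then F is monotone, and along an enumeration of
  a the union becomes that of an increasing \<omega>-sequence in the club.\<close>

lemma club_small_closure:
  fixes A :: "'a set"
  assumes club: "club_small omega1 A \<C>"
  obtains F :: "'a set \<Rightarrow> 'a set"
  where "\<And>e. finite e \<Longrightarrow> e \<subseteq> A \<Longrightarrow> F e \<subseteq> A \<and> countable (F e) \<and> e \<subseteq> F e"
    and "\<And>a. a \<noteq> {} \<Longrightarrow> countable a \<Longrightarrow> a \<subseteq> A \<Longrightarrow> (\<Union>e \<in> {e. finite e \<and> e \<subseteq> a}. F e) \<in> \<C>"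
proof -
  note small = club_small_subset[OF club]
  \<comment> \<open>For e infinite or not contained in A the condition is vacuous, so the recursion
    can run over all sets.\<close>
  define P where "P f e y \<longleftrightarrow> (finite e \<longrightarrow> e \<subseteq> A \<longrightarrow> y \<in> \<C> \<and> e \<subseteq> y \<and> (\<forall>e'. e' \<subset> e \<longrightarrow> f e' \<subseteq> y))"
    for f :: "'a set \<Rightarrow> 'a set" and e y
  have "\<exists>F. \<forall>e. P F e (F e)"
  proof (rule dependent_wf_choice[OF wf_finite_psubset])
    fix f g :: "'a set \<Rightarrow> 'a set" and e y
    assume "\<And>z. (z, e) \<in> finite_psubset \<Longrightarrow> f z = g z"
    then show "P f e y = P g e y" unfolding P_def finite_psubset_def by auto
  next
    fix e and f :: "'a set \<Rightarrow> 'a set"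
    assume IH: "\<And>e'. (e', e) \<in> finite_psubset \<Longrightarrow> P f e' (f e')"
    show "\<exists>y. P f e y"
    proof (cases "finite e \<and> e \<subseteq> A")
      case True
      have sub: "f e' \<subseteq> A \<and> countable (f e')" if "e' \<subset> e" for e'
      proof -
        have "finite e'" "e' \<subseteq> A" using True that finite_subset by auto
        moreover have "P f e' (f e')" using IH[of e'] that True unfolding finite_psubset_def by simp
        ultimately have "f e' \<in> \<C>" unfolding P_def by simp
        then show ?thesis by (rule small)
      qed
      let ?x = "e \<union> (\<Union>e' \<in> {e'. e' \<subset> e}. f e')"
      have "finite {e'. e' \<subset> e}"
        by (rule finite_subset[of _ "Pow e"]) (use True in auto)
      then have "countable ?x"
        using True sub by (intro countable_Un countable_UN) (auto intro: countable_finite)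
      have "?x \<subseteq> A" using sub True by auto
      from club_small_cofinal[OF club this \<open>countable ?x\<close>]
      obtain y where "y \<in> \<C>" "?x \<subseteq> y" by (elim bexE)
      then have "P f e y" unfolding P_def by auto
      then show ?thesis ..
    next
      case False
      then show ?thesis unfolding P_def by blast
    qed
  qed
  then obtain F where F: "\<And>e. P F e (F e)" by blast
  have F1: "F e \<in> \<C> \<and> e \<subseteq> F e" if "finite e" "e \<subseteq> A" for e
    using F[of e] that unfolding P_def by blast
  have F2: "F e' \<subseteq> F e" if "finite e" "e \<subseteq> A" "e' \<subseteq> e" for e e'
    using F[of e] that unfolding P_def by blast
  show ?thesis
  proof (rule that[of F])
    show "F e \<subseteq> A \<and> countable (F e) \<and> e \<subseteq> F e" if "finite e" "e \<subseteq> A" for e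
      using F1[OF that] small[of "F e"] by simp
    fix a assume a: "a \<noteq> {}" "countable a" "a \<subseteq> A"
    let ?s = "from_nat_into a"
    have ran: "range ?s = a" using a(1,2) by (rule range_from_nat_into)
    have sub: "?s ` {..n} \<subseteq> A" for n using ran a(3) by blast
    have "(\<Union>n. F (?s ` {..n})) \<in> \<C>"
    proof (rule club_small_Union_seq[OF club])
      show "F (?s ` {..n}) \<in> \<C>" for n using F1[OF _ sub] by simp
      show "F (?s ` {..n}) \<subseteq> F (?s ` {..Suc n})" for n
        using F2[OF _ sub[of "Suc n"]] by (simp add: image_mono)
    qed
    moreover have "(\<Union>e \<in> {e. finite e \<and> e \<subseteq> a}. F e) = (\<Union>n. F (?s ` {..n}))"
    proof
      show "(\<Union>n. F (?s ` {..n})) \<subseteq> (\<Union>e \<in> {e. finite e \<and> e \<subseteq> a}. F e)"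
      proof (rule UN_least)
        fix n
        have "?s ` {..n} \<in> {e. finite e \<and> e \<subseteq> a}" using ran by auto
        then show "F (?s ` {..n}) \<subseteq> (\<Union>e \<in> {e. finite e \<and> e \<subseteq> a}. F e)" by blast
      qed
      show "(\<Union>e \<in> {e. finite e \<and> e \<subseteq> a}. F e) \<subseteq> (\<Union>n. F (?s ` {..n}))"
      proof (rule UN_least)
        fix e assume "e \<in> {e. finite e \<and> e \<subseteq> a}"
        moreover have "a \<subseteq> (\<Union>n. ?s ` {..n})"
        proof
          fix x assume "x \<in> a"
          then obtain n where "x = ?s n" using ran by (metis rangeE)
          then show "x \<in> (\<Union>n. ?s ` {..n})" by auto
        qed
        ultimately have e: "finite e" "e \<subseteq> (\<Union>n. ?s ` {..n})" by auto
        obtain n where "e \<subseteq> ?s ` {..n}"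
          using finite_subset_increasing_Union[OF e] by (meson atMost_subset_iff image_mono le_SucI order_refl)
        then show "F e \<subseteq> (\<Union>n. F (?s ` {..n}))" using F2[OF _ sub, of n e] by blast
      qed
    qed
    ultimately show "(\<Union>e \<in> {e. finite e \<and> e \<subseteq> a}. F e) \<in> \<C>" by simp
  qed
qed

section \<open>A game of length \<omega> on \<lambda>\<close>

context regular_order
begin

text \<open>Positions of a game in which two players alternately choose \<open>\<gamma>\<^sub>n < \<lambda>\<close> and \<open>\<beta>\<^sub>n > \<gamma>\<^sub>n\<close>;
  a position lists the moves \<open>\<beta>\<^sub>n\<close>, the last one first. A position is losing if the first player
  can force a bad position.\<close>

inductive losing :: "('a list \<Rightarrow> bool) \<Rightarrow> 'a list \<Rightarrow> bool" for bad where
  bad: "bad s \<Longrightarrow> losing bad s"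
| move: "\<gamma> \<in> Field r \<Longrightarrow> (\<And>\<beta>. \<gamma> \<lhd> \<beta> \<Longrightarrow> losing bad (\<beta> # s)) \<Longrightarrow> losing bad s"

definition moves :: "(nat \<Rightarrow> 'a) \<Rightarrow> nat \<Rightarrow> 'a list \<Rightarrow> 'a list" where
  "moves b n s = rev (map b [0..<n]) @ s"

lemma moves_0 [simp]: "moves b 0 s = s"
  by (simp add: moves_def)

lemma moves_Suc: "moves b (Suc n) s = b n # moves b n s"
  by (simp add: moves_def)

text \<open>Absorbs the first move into the starting position, as the induction on
  \<open>losing\<close> requires.\<close>

lemma moves_Suc': "moves b (Suc n) s = moves (\<lambda>n. b (Suc n)) n (b 0 # s)"
  by (induction n) (simp_all add: moves_Suc)

lemma length_moves: "length (moves b n s) = n + length s"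
  by (simp add: moves_def)

text \<open>Induction on the derivation of \<open>losing\<close>. After the first move \<gamma>,
  each answer \<beta> leads to a position with its own strategy \<open>g \<beta>\<close>; the
  strategies are glued by reading \<beta> off the current position.\<close>

lemma losing_strategy:
  assumes "losing bad s"
  shows "\<exists>g. (\<forall>t. g t \<in> Field r) \<and>
    (\<forall>b. (\<forall>n. g (moves b n s) \<lhd> b n) \<longrightarrow> (\<exists>n. bad (moves b n s)))"
  using assms
proof induction
  case (bad s)
  obtain x where "x \<in> Field r" using infinite_Field by fastforce
  then show ?case using bad by (intro exI[of _ "\<lambda>_. x"]) (metis moves_0)
next
  case (move \<gamma> s)
  let ?Q = "\<lambda>\<beta> g. (\<forall>t. g t \<in> Field r) \<and>
    (\<forall>b. (\<forall>n. g (moves b n (\<beta> # s)) \<lhd> b n) \<longrightarrow> (\<exists>n. bad (moves b n (\<beta> # s))))"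
  have "\<exists>g. \<forall>\<beta>. \<gamma> \<lhd> \<beta> \<longrightarrow> ?Q \<beta> (g \<beta>)"
    using move.IH by (intro choice) blast
  then obtain g where g: "\<And>\<beta>. \<gamma> \<lhd> \<beta> \<Longrightarrow> ?Q \<beta> (g \<beta>)" by auto
  \<comment> \<open>The newest move comes first, so the first answer is the entry directly in front
    of the final segment s.\<close>
  define first where "first t = t ! (length t - Suc (length s))" for t :: "'a list"
  \<comment> \<open>The value \<gamma> is the opening move at s itself; on lists that do not arise
    from a legal answer it is only a default.\<close>
  define G where "G t = (if \<gamma> \<lhd> first t \<and> length t > length s then g (first t) t else \<gamma>)" for t
  have "G t \<in> Field r" for t
    unfolding G_def using g move.hyps(1) by auto
  moreover have "\<exists>n. bad (moves b n s)" if b: "\<forall>n. G (moves b n s) \<lhd> b n" for b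
  proof -
    have b0: "\<gamma> \<lhd> b 0" using b[rule_format, of 0] unfolding G_def by simp
    have f: "first (moves b (Suc n) s) = b 0" for n
    proof -
      have "length (moves b (Suc n) s) - Suc (length s) = n" by (simp add: length_moves)
      moreover have "moves b (Suc n) s ! n = b 0"
        unfolding moves_def by (subst nth_append_left) (simp_all add: rev_nth del: upt_Suc)
      ultimately show ?thesis unfolding first_def by simp
    qed
    have "g (b 0) (moves (\<lambda>n. b (Suc n)) n (b 0 # s)) \<lhd> b (Suc n)" for n
    proof -
      have "length s < length (moves b (Suc n) s)" by (simp add: length_moves)
      then have "G (moves b (Suc n) s) = g (b 0) (moves b (Suc n) s)"
        unfolding G_def f using b0 by simp
      then show ?thesis using b[rule_format, of "Suc n"] by (simp only: moves_Suc')
    qed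
    then obtain n where "bad (moves (\<lambda>n. b (Suc n)) n (b 0 # s))"
      using g[OF b0] by blast
    then show ?thesis by (metis moves_Suc')
  qed
  ultimately show ?case by blast
qed

lemma cof_omega_finite_bound:
  assumes "\<beta> \<in> cof_omega" "finite e" "e \<subseteq> underS r \<beta>"
  shows "\<exists>m. m \<lhd> \<beta> \<and> e \<subseteq> underS r m"
  using assms(2,3)
proof (induction e)
  case empty
  then show ?case using assms(1) unfolding cof_omega_def by auto
next
  case (insert x e)
  then obtain m where m: "m \<lhd> \<beta>" "e \<subseteq> underS r m" by auto
  have above: "\<exists>y. x \<lhd> y \<and> y \<lhd> \<beta>" if "x \<lhd> \<beta>" for x
    using assms(1) that unfolding cof_omega_def by blast
  obtain y where y: "x \<lhd> y" "y \<lhd> \<beta>" using above insert.prems by auto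
  show ?case
  proof (cases "m \<lhd> y")
    case True
    then show ?thesis using m y underS_mono[OF lt_imp_le[OF True]] by blast
  next
    case False
    then have "y \<unlhd> m" using not_lt_iff lt_Field[OF m(1)] lt_Field[OF y(2)] by blast
    then show ?thesis using m y lt_le_trans[OF y(1)] by blast
  qed
qed

text \<open>Regularity bounds g on lists of each fixed length, by induction on the length, and then
  over the countably many lengths.\<close>

lemma bounded_lists:
  assumes "\<alpha> \<in> Field r" "\<And>s. g s \<in> Field r"
  shows "\<exists>b \<in> Field r. \<forall>s \<in> lists (underS r \<alpha>). g s \<lhd> b"
proof -
  have "\<exists>b \<in> Field r. \<forall>s \<in> lists (underS r \<alpha>). length s = n \<longrightarrow> g s \<lhd> b"
    if "\<And>s. g s \<in> Field r" for n g
    using that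
  proof (induction n arbitrary: g)
    case 0
    obtain b where "g [] \<lhd> b" using gt_exists[of "g []"] 0 by blast
    then show ?case using lt_Field[of "g []" b] by (intro bexI[of _ b]) auto
  next
    case (Suc n)
    have "\<forall>x. \<exists>b \<in> Field r. \<forall>s \<in> lists (underS r \<alpha>). length s = n \<longrightarrow> g (x # s) \<lhd> b"
      using Suc.IH Suc.prems by simp
    then obtain b where b: "\<And>x. b x \<in> Field r"
      "\<And>x s. s \<in> lists (underS r \<alpha>) \<Longrightarrow> length s = n \<Longrightarrow> g (x # s) \<lhd> b x"
      by metis
    obtain c where c: "c \<in> Field r" "\<And>x. x \<lhd> \<alpha> \<Longrightarrow> b x \<lhd> c"
      using bounded_image[OF card_of_underS[OF Card assms(1)], of b] b(1) by auto
    have "g s \<lhd> c" if s: "s \<in> lists (underS r \<alpha>)" "length s = Suc n" for s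
    proof -
      obtain x t where "s = x # t" using s(2) by (auto simp: length_Suc_conv)
      then show ?thesis using s b(2)[of t x] c(2)[of x] lt_trans by simp
    qed
    then show ?case using c(1) by blast
  qed
  then have "\<forall>n. \<exists>b \<in> Field r. \<forall>s \<in> lists (underS r \<alpha>). length s = n \<longrightarrow> g s \<lhd> b"
    using assms(2) by simp
  then obtain b where b: "\<And>n. b n \<in> Field r"
    "\<And>s. s \<in> lists (underS r \<alpha>) \<Longrightarrow> g s \<lhd> b (length s)" by metis
  obtain c where c: "c \<in> Field r" "\<And>n::nat. b n \<lhd> c"
    using bounded_countable[of "range b"] b(1) by auto
  show ?thesis using c(1) lt_trans[OF b(2) c(2)] by blast
qed

text \<open>These are the bad positions of the game for \<xi>. While they are avoided, applying F to
  finite sets of moves and ordinals below \<xi> adds no countable ordinal from \<xi> on.\<close>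

definition escapes :: "('a set \<Rightarrow> 'a set) \<Rightarrow> 'a \<Rightarrow> 'a list \<Rightarrow> bool" where
  "escapes F \<xi> s \<longleftrightarrow>
     (\<exists>e. finite e \<and> e \<subseteq> set s \<union> underS r \<xi> \<and> \<not> F e \<inter> omega1_in r \<subseteq> underS r \<xi>)"

text \<open>Otherwise the first player would have a winning strategy for every \<open>\<xi> < \<omega>\<^sub>1\<close>. As \<open>\<lambda> > \<omega>\<^sub>1\<close> is
  regular, one sequence of moves of the second player would answer all of them at once, and some
  \<open>\<xi>\<close> would be closed under \<open>F\<close> relative to it.\<close>

lemma not_losing_exists:
  assumes F: "\<And>e. finite e \<Longrightarrow> e \<subseteq> Field r \<Longrightarrow> countable (F e)"
  shows "\<exists>\<xi> \<in> omega1_in r. \<not> losing (escapes F \<xi>) []"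
proof (rule ccontr)
  assume "\<not> ?thesis"
  then have "\<forall>\<xi> \<in> omega1_in r. \<exists>g. (\<forall>t. g t \<in> Field r) \<and>
      (\<forall>b. (\<forall>n. g (moves b n []) \<lhd> b n) \<longrightarrow> (\<exists>n. escapes F \<xi> (moves b n [])))"
    using losing_strategy by blast
  then obtain g where g': "\<forall>\<xi> \<in> omega1_in r. (\<forall>t. g \<xi> t \<in> Field r) \<and>
      (\<forall>b. (\<forall>n. g \<xi> (moves b n []) \<lhd> b n) \<longrightarrow> (\<exists>n. escapes F \<xi> (moves b n [])))"
    by (rule bchoice[THEN exE])
  then have g: "\<And>\<xi> t. \<xi> \<in> omega1_in r \<Longrightarrow> g \<xi> t \<in> Field r"
    "\<And>\<xi> b. \<xi> \<in> omega1_in r \<Longrightarrow> (\<And>n. g \<xi> (moves b n []) \<lhd> b n) \<Longrightarrow>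
       \<exists>n. escapes F \<xi> (moves b n [])"
    by blast+
  have "\<forall>t. \<exists>x \<in> Field r. \<forall>\<xi> \<in> omega1_in r. g \<xi> t \<lhd> x"
    using bounded_image[OF omega1_in_small] g(1) by (simp add: image_subset_iff)
  then obtain nxt where nxt: "\<And>t. nxt t \<in> Field r" "\<And>t \<xi>. \<xi> \<in> omega1_in r \<Longrightarrow> g \<xi> t \<lhd> nxt t"
    by metis
  \<comment> \<open>Iterating \<open>nxt\<close> produces one play that is legal against all
    strategies \<open>g \<xi>\<close> simultaneously.\<close>
  define S where "S = rec_nat [] (\<lambda>n s. nxt s # s)"
  define b where "b n = nxt (S n)" for n
  have S: "S n = moves b n []" for n
    by (induction n) (simp_all add: S_def b_def moves_Suc)
  have escapes: "\<exists>n. escapes F \<xi> (moves b n [])" if "\<xi> \<in> omega1_in r" for \<xi>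
  proof (rule g(2)[OF that])
    fix n
    have "g \<xi> (S n) \<lhd> b n" using nxt(2)[OF that] by (simp add: b_def)
    then show "g \<xi> (moves b n []) \<lhd> b n" by (simp only: S)
  qed
  have bF: "range b \<subseteq> Field r" using nxt(1) unfolding b_def by blast
  have step: "\<exists>y \<in> omega1_in r. x \<lhd> y \<and>
      (\<forall>e. finite e \<longrightarrow> e \<subseteq> range b \<union> underS r x \<longrightarrow> F e \<inter> omega1_in r \<subseteq> underS r y)"
    if x: "x \<in> omega1_in r" for x
  proof -
    let ?E = "{e. finite e \<and> e \<subseteq> range b \<union> underS r x}"
    have sub: "range b \<union> underS r x \<subseteq> Field r" using bF lt_Field by blast
    have "countable ?E"
      using countable_Collect_finite_subset[of "range b \<union> underS r x"] countable_underS_omega1[OF x]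
      by simp
    then have "countable (\<Union>e \<in> ?E. F e)"
    proof (rule countable_UN)
      fix e assume "e \<in> ?E"
      then have "finite e" "e \<subseteq> Field r" using sub by auto
      then show "countable (F e)" by (rule F)
    qed
    then have cnt: "countable (insert x ((\<Union>e \<in> ?E. F e) \<inter> omega1_in r))" by simp
    have "insert x ((\<Union>e \<in> ?E. F e) \<inter> omega1_in r) \<subseteq> omega1_in r" using x by simp
    from omega1_in_bounded[OF cnt this] obtain y where y: "y \<in> omega1_in r"
      "\<forall>z \<in> insert x ((\<Union>e \<in> ?E. F e) \<inter> omega1_in r). z \<lhd> y" by (elim bexE)
    have "F e \<inter> omega1_in r \<subseteq> underS r y" if "finite e" "e \<subseteq> range b \<union> underS r x" for e
    proof
      fix z assume "z \<in> F e \<inter> omega1_in r"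
      then have "z \<in> insert x ((\<Union>e \<in> ?E. F e) \<inter> omega1_in r)" using that by blast
      then show "z \<lhd> y" by (rule y(2)[THEN bspec])
    qed
    moreover have "x \<lhd> y" using y(2) by simp
    ultimately show ?thesis using y(1) by (intro bexI[of _ y] conjI allI impI)
  qed
  obtain x0 where x0: "x0 \<in> omega1_in r"
    using uncountable_omega1_in by fastforce
  obtain z :: "nat \<Rightarrow> 'a" where z: "\<And>n. z n \<in> omega1_in r" "\<And>n. z n \<lhd> z (Suc n)"
    "\<And>n e. finite e \<Longrightarrow> e \<subseteq> range b \<union> underS r (z n) \<Longrightarrow>
       F e \<inter> omega1_in r \<subseteq> underS r (z (Suc n))"
  proof -
    have "\<exists>z. \<forall>n::nat. z n \<in> omega1_in r \<and> (z n \<lhd> z (Suc n) \<and> (\<forall>e. finite e \<longrightarrow>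
        e \<subseteq> range b \<union> underS r (z n) \<longrightarrow> F e \<inter> omega1_in r \<subseteq> underS r (z (Suc n))))"
    proof (rule dependent_nat_choice)
      show "\<exists>x. x \<in> omega1_in r" using x0 by (rule exI)
    next
      fix x and n :: nat
      assume "x \<in> omega1_in r"
      from step[OF this] show "\<exists>y. y \<in> omega1_in r \<and> (x \<lhd> y \<and> (\<forall>e. finite e \<longrightarrow>
          e \<subseteq> range b \<union> underS r x \<longrightarrow> F e \<inter> omega1_in r \<subseteq> underS r y))"
        by (simp only: Bex_def)
    qed
    then obtain z where "\<forall>n::nat. z n \<in> omega1_in r \<and> (z n \<lhd> z (Suc n) \<and> (\<forall>e. finite e \<longrightarrow>
        e \<subseteq> range b \<union> underS r (z n) \<longrightarrow> F e \<inter> omega1_in r \<subseteq> underS r (z (Suc n))))" ..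
    then show ?thesis by (intro that[of z]) simp_all
  qed
  obtain y where y: "y \<in> omega1_in r" "\<forall>x \<in> range z. x \<lhd> y"
    using omega1_in_bounded[of "range z"] z(1) by auto
  have yF: "y \<in> Field r" using y(1) omega1_in_Field by blast
  \<comment> \<open>The supremum of the \<open>z n\<close>. A finite set of moves and ordinals below
    \<xi> already appears at some \<open>z m\<close>, so F leads no further than
    \<open>z (Suc m)\<close>.\<close>
  obtain \<xi> where \<xi>: "\<xi> \<in> Field r" "\<forall>x \<in> range z. x \<lhd> \<xi>"
    and least: "\<And>c. c \<lhd> \<xi> \<Longrightarrow> \<not> (\<forall>x \<in> range z. x \<lhd> c)" and \<xi>y: "\<xi> \<unlhd> y"
    using least_exists[OF yF, of "\<lambda>b. \<forall>x \<in> range z. x \<lhd> b", OF y(2)] by metis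
  have \<xi>1: "\<xi> \<in> omega1_in r" using le_cases[OF \<xi>y] y(1) omega1_in_down by blast
  obtain n where "escapes F \<xi> (moves b n [])" using escapes[OF \<xi>1] by blast
  then obtain e where e: "finite e" "e \<subseteq> set (moves b n []) \<union> underS r \<xi>"
    "\<not> F e \<inter> omega1_in r \<subseteq> underS r \<xi>"
    unfolding escapes_def by blast
  have "underS r \<xi> \<subseteq> (\<Union>n. underS r (z n))"
  proof
    fix \<alpha> assume \<alpha>: "\<alpha> \<lhd> \<xi>"
    then obtain n where "\<not> z n \<lhd> \<alpha>" using least by blast
    then have "\<alpha> \<unlhd> z n" using not_lt_iff z(1) omega1_in_Field lt_Field[OF \<alpha>] by blast
    then show "\<alpha> \<in> (\<Union>n. underS r (z n))" using le_lt_trans z(2) by blast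
  qed
  then have "e \<subseteq> (\<Union>n. range b \<union> underS r (z n))"
    using e(2) by (auto simp: moves_def)
  then obtain m where "e \<subseteq> range b \<union> underS r (z m)"
    using finite_subset_increasing_Union[OF e(1), of "\<lambda>n. range b \<union> underS r (z n)"]
      underS_mono[OF lt_imp_le[OF z(2)]] by blast
  then have "F e \<inter> omega1_in r \<subseteq> underS r (z (Suc m))" using z(3) e(1) by blast
  then show False using e(3) \<xi>(2) underS_mono lt_imp_le by blast
qed

text \<open>Fix a \<xi> for which the second player can avoid bad positions, and pick \<beta> in
  \<open>A \<xi>\<close> of cofinality \<omega> closed under that player's answers and under bounds
  for F. Let the first player run through a sequence cofinal in \<beta>. The set generated by F from
  \<xi> and the answers has supremum \<beta> by closure and trace \<xi> because no position was
  bad.\<close>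

lemma club_meets_not_null:
  assumes club: "club_small omega1 (Field r) \<C>"
    and A: "\<forall>\<xi> \<in> omega1_in r. \<not> null (A \<xi>)"
  shows "\<exists>y \<in> \<C>. \<exists>\<xi> \<in> omega1_in r. \<exists>\<beta> \<in> A \<xi>. \<beta> \<in> cof_omega \<and> y \<in> omega_subsets (Field r) \<and>
    y \<subseteq> underS r \<beta> \<and> (\<forall>\<alpha>. \<alpha> \<lhd> \<beta> \<longrightarrow> (\<exists>\<gamma> \<in> y. \<alpha> \<lhd> \<gamma>)) \<and> y \<inter> omega1_in r = underS r \<xi>"
proof -
  obtain F :: "'a set \<Rightarrow> 'a set"
    where F: "\<And>e. finite e \<Longrightarrow> e \<subseteq> Field r \<Longrightarrow> F e \<subseteq> Field r \<and> countable (F e) \<and> e \<subseteq> F e"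
    and cl: "\<And>a. a \<noteq> {} \<Longrightarrow> countable a \<Longrightarrow> a \<subseteq> Field r \<Longrightarrow>
      (\<Union>e \<in> {e. finite e \<and> e \<subseteq> a}. F e) \<in> \<C>"
    by (rule club_small_closure[OF club]) (assumption | rule that)+
  obtain \<xi> where \<xi>: "\<xi> \<in> omega1_in r" "\<not> losing (escapes F \<xi>) []"
    using not_losing_exists[of F] F by blast
  define win where "win s \<longleftrightarrow> \<not> losing (escapes F \<xi>) s" for s
  have win_nil: "win []" unfolding win_def by (rule \<xi>(2))
  have win_safe: "\<not> escapes F \<xi> s" if "win s" for s
    using that losing.bad unfolding win_def by blast
  have win_next: "\<exists>\<beta>. \<gamma> \<lhd> \<beta> \<and> win (\<beta> # s)" if "win s" "\<gamma> \<in> Field r" for s \<gamma>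
    using that losing.move unfolding win_def by blast
  have \<xi>F: "\<xi> \<in> Field r" using \<xi>(1) omega1_in_Field by blast
  \<comment> \<open>The list t is read as \<gamma> # s, the move \<gamma> of the first player at
    position s. The default \<xi> only keeps the values in \<lambda>.\<close>
  define step where "step t = (if \<exists>\<beta>. hd t \<lhd> \<beta> \<and> win (\<beta> # tl t)
    then SOME \<beta>. hd t \<lhd> \<beta> \<and> win (\<beta> # tl t) else \<xi>)" for t
  have step: "\<gamma> \<lhd> step (\<gamma> # s) \<and> win (step (\<gamma> # s) # s)" if "win s" "\<gamma> \<in> Field r" for \<gamma> s
    using someI_ex[OF win_next[OF that]] win_next[OF that] unfolding step_def by simp
  have stepF: "step t \<in> Field r" for t
  proof (cases "\<exists>\<beta>. hd t \<lhd> \<beta> \<and> win (\<beta> # tl t)")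
    case True
    then show ?thesis using someI_ex[OF True] lt_Field[of "hd t" "step t"] unfolding step_def by simp
  next
    case False
    then show ?thesis using \<xi>F unfolding step_def by auto
  qed
  have "\<exists>b \<in> Field r. set t \<subseteq> Field r \<longrightarrow> (\<forall>x \<in> F (set t). x \<lhd> b)" for t
  proof (cases "set t \<subseteq> Field r")
    case True
    then show ?thesis using bounded_countable[of "F (set t)"] F[of "set t"] by auto
  next
    case False
    then show ?thesis using \<xi>F by blast
  qed
  then obtain G where G: "\<And>t. G t \<in> Field r"
    "\<And>t x. set t \<subseteq> Field r \<Longrightarrow> x \<in> F (set t) \<Longrightarrow> x \<lhd> G t" by metis
  \<comment> \<open>A finite list below \<beta> lies below some m < \<beta>, so closure of \<beta>
    under the single function f obtained here gives closure under \<open>step\<close> and G.\<close>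
  have "\<exists>b \<in> Field r. \<xi> \<lhd> b \<and> (\<forall>t \<in> lists (underS r \<alpha>). step t \<lhd> b \<and> G t \<lhd> b)"
    if \<alpha>: "\<alpha> \<in> Field r" for \<alpha>
  proof -
    obtain b1 where b1: "b1 \<in> Field r" "\<forall>t \<in> lists (underS r \<alpha>). step t \<lhd> b1"
      using bounded_lists[OF \<alpha>, of step] stepF by blast
    obtain b2 where b2: "b2 \<in> Field r" "\<forall>t \<in> lists (underS r \<alpha>). G t \<lhd> b2"
      using bounded_lists[OF \<alpha>, of G] G(1) by blast
    obtain b where b: "b \<in> Field r" "\<forall>x \<in> {\<xi>, b1, b2}. x \<lhd> b"
      using bounded_countable[of "{\<xi>, b1, b2}"] b1(1) b2(1) \<xi>F by auto
    have "step t \<lhd> b \<and> G t \<lhd> b" if "t \<in> lists (underS r \<alpha>)" for t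
      using b(2) b1(2) b2(2) that lt_trans[of _ b1 b] lt_trans[of _ b2 b] by simp
    then show ?thesis using b by auto
  qed
  then obtain f where f: "\<And>\<alpha>. \<alpha> \<in> Field r \<Longrightarrow> f \<alpha> \<in> Field r \<and> \<xi> \<lhd> f \<alpha>"
    "\<And>\<alpha> t. \<alpha> \<in> Field r \<Longrightarrow> t \<in> lists (underS r \<alpha>) \<Longrightarrow> step t \<lhd> f \<alpha> \<and> G t \<lhd> f \<alpha>"
    by metis
  have "\<exists>\<beta> \<in> A \<xi> \<inter> cof_omega. \<forall>\<alpha>. \<alpha> \<lhd> \<beta> \<longrightarrow> f \<alpha> \<lhd> \<beta>"
  proof (rule ccontr)
    assume "\<not> ?thesis"
    then have "null (A \<xi>)" unfolding null_def using f(1) by (intro exI[of _ f]) auto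
    then show False using A \<xi>(1) by blast
  qed
  then obtain \<beta> where \<beta>: "\<beta> \<in> A \<xi>" "\<beta> \<in> cof_omega" "\<And>\<alpha>. \<alpha> \<lhd> \<beta> \<Longrightarrow> f \<alpha> \<lhd> \<beta>" by blast
  have closed: "step t \<lhd> \<beta> \<and> G t \<lhd> \<beta>" if t: "set t \<subseteq> underS r \<beta>" for t
  proof -
    obtain m where m: "m \<lhd> \<beta>" "set t \<subseteq> underS r m"
      using cof_omega_finite_bound[OF \<beta>(2) finite_set t] by blast
    have "step t \<lhd> f m \<and> G t \<lhd> f m" using f(2)[of m t] m lt_Field[OF m(1)] by auto
    then show ?thesis using \<beta>(3)[OF m(1)] lt_trans by blast
  qed
  obtain c :: "nat \<Rightarrow> 'a" where c: "\<And>n. c n \<lhd> \<beta>" "\<And>\<alpha>. \<alpha> \<lhd> \<beta> \<Longrightarrow> \<exists>n. \<alpha> \<lhd> c n"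
    using \<beta>(2) unfolding cof_omega_def by auto
  have \<xi>\<beta>: "\<xi> \<lhd> \<beta>" using f(1)[of "c 0"] \<beta>(3)[OF c(1)] lt_Field[OF c(1)] lt_trans by blast
  define S where "S = rec_nat [] (\<lambda>n s. step (c n # s) # s)"
  have S0: "S 0 = []" and SSuc: "\<And>n. S (Suc n) = step (c n # S n) # S n" by (simp_all add: S_def)
  have S: "win (S n) \<and> set (S n) \<subseteq> underS r \<beta>" for n
  proof (induction n)
    case 0
    then show ?case using win_nil by (simp add: S0)
  next
    case (Suc n)
    have "step (c n # S n) \<lhd> \<beta>" using closed[of "c n # S n"] c(1) Suc by simp
    moreover have "win (step (c n # S n) # S n)"
      using step[of "S n" "c n"] Suc lt_Field[OF c(1)] by blast
    ultimately show ?case using Suc by (simp add: SSuc)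
  qed
  define a where "a = underS r \<xi> \<union> (\<Union>n. set (S n))"
  define y where "y = (\<Union>e \<in> {e. finite e \<and> e \<subseteq> a}. F e)"
  have a_below: "a \<subseteq> underS r \<beta>"
    unfolding a_def using S underS_mono[OF lt_imp_le[OF \<xi>\<beta>]] by blast
  then have aF: "a \<subseteq> Field r" using lt_Field by blast
  have a_ctble: "countable a"
    unfolding a_def using countable_underS_omega1[OF \<xi>(1)] by (auto intro: countable_finite)
  have in_a: "step (c n # S n) \<in> a" for n
  proof -
    have "step (c n # S n) \<in> set (S (Suc n))" by (simp add: SSuc)
    then show ?thesis unfolding a_def by blast
  qed
  have y_in: "y \<in> \<C>" unfolding y_def using in_a by (intro cl a_ctble aF) auto
  then have y_small: "y \<subseteq> Field r \<and> countable y"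
    by (rule club_small_subset[OF club])
  have ay: "a \<subseteq> y"
  proof
    fix x assume x: "x \<in> a"
    have "x \<in> F {x}" using F[of "{x}"] x aF by auto
    then show "x \<in> y" unfolding y_def using x by (intro UN_I[of "{x}"]) auto
  qed
  have y_below: "y \<subseteq> underS r \<beta>"
  proof
    fix x assume "x \<in> y"
    then obtain e where e: "finite e" "e \<subseteq> a" "x \<in> F e" unfolding y_def by blast
    obtain t where t: "set t = e" using finite_list[OF e(1)] by blast
    have "x \<lhd> G t" using G(2)[of t x] t e aF by auto
    moreover have "G t \<lhd> \<beta>" using closed[of t] t e(2) a_below by auto
    ultimately show "x \<lhd> \<beta>" by (rule lt_trans)
  qed
  have unb: "\<exists>\<gamma> \<in> y. \<alpha> \<lhd> \<gamma>" if \<alpha>: "\<alpha> \<lhd> \<beta>" for \<alpha>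
  proof -
    obtain n where n: "\<alpha> \<lhd> c n" using c(2)[OF \<alpha>] by blast
    have "c n \<lhd> step (c n # S n)"
      using step[of "S n" "c n"] S lt_Field[OF c(1)] by blast
    then have "\<alpha> \<lhd> step (c n # S n)" using n lt_trans by blast
    then show ?thesis using in_a ay by blast
  qed
  have "infinite y"
  proof
    assume "finite y"
    then obtain m where m: "m \<lhd> \<beta>" "y \<subseteq> underS r m"
      using cof_omega_finite_bound[OF \<beta>(2) _ y_below] by blast
    obtain \<gamma> where \<gamma>: "\<gamma> \<in> y" "m \<lhd> \<gamma>" using unb[OF m(1)] by blast
    then have "\<gamma> \<lhd> m" using m(2) by blast
    then show False using lt_trans[OF \<gamma>(2)] lt_irrefl by blast
  qed
  then have y_om: "y \<in> omega_subsets (Field r)" using y_small by (simp add: omega_subsets_iff)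
  have y1: "y \<inter> omega1_in r = underS r \<xi>"
  proof
    show "underS r \<xi> \<subseteq> y \<inter> omega1_in r"
      using ay omega1_in_down[OF \<xi>(1)] unfolding a_def by blast
    show "y \<inter> omega1_in r \<subseteq> underS r \<xi>"
    proof
      fix x assume x: "x \<in> y \<inter> omega1_in r"
      then obtain e where e: "finite e" "e \<subseteq> a" "x \<in> F e" unfolding y_def by blast
      have "e \<subseteq> (\<Union>n. set (S n) \<union> underS r \<xi>)" using e(2) unfolding a_def by blast
      moreover have "set (S n) \<union> underS r \<xi> \<subseteq> set (S (Suc n)) \<union> underS r \<xi>" for n
        by (auto simp: SSuc)
      ultimately obtain n where "e \<subseteq> set (S n) \<union> underS r \<xi>"
        using finite_subset_increasing_Union[OF e(1), of "\<lambda>n. set (S n) \<union> underS r \<xi>"] by blast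
      then have "F e \<inter> omega1_in r \<subseteq> underS r \<xi>"
        using win_safe[of "S n"] S e(1) unfolding escapes_def by blast
      then show "x \<lhd> \<xi>" using x e(3) by blast
    qed
  qed
  show ?thesis using y_in \<xi>(1) \<beta>(1,2) y_om y_below unb y1 by blast
qed

end

subsection \<open>Failure of reflection\<close>

text \<open>Closing off \<omega> times keeps a set countable. In an increasing union any two
  elements already lie in a common member, so two arguments of G cause no difficulty.\<close>

lemma club_small_closed_sets:
  assumes G: "\<And>i j. countable (G i j)"
  shows "club_small omega1 I {x. x \<subseteq> I \<and> countable x \<and> (\<forall>i \<in> x. \<forall>j \<in> x. G i j \<inter> I \<subseteq> x)}"
    (is "club_small omega1 I ?C")
  unfolding club_small_def
proof (intro conjI ballI allI impI)
  show "?C \<subseteq> small_subsets omega1 I" unfolding small_subsets_omega1 by auto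
next
  fix x assume "x \<in> small_subsets omega1 I"
  then have x: "x \<subseteq> I" "countable x" unfolding small_subsets_omega1 by auto
  define X where "X = rec_nat x (\<lambda>_ u. u \<union> (\<Union>i \<in> u. \<Union>j \<in> u. G i j \<inter> I))"
  have X0: "X 0 = x" and XSuc: "\<And>n. X (Suc n) = X n \<union> (\<Union>i \<in> X n. \<Union>j \<in> X n. G i j \<inter> I)"
    by (simp_all add: X_def)
  have X: "X n \<subseteq> I \<and> countable (X n)" for n
    by (induction n) (use x G in \<open>auto simp: X0 XSuc\<close>)
  have mono: "X m \<subseteq> X n" if "m \<le> n" for m n
    by (rule lift_Suc_mono_le[OF _ that]) (auto simp: XSuc)
  have "G i j \<inter> I \<subseteq> (\<Union>n. X n)" if "i \<in> X m" "j \<in> X n" for i j m n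
  proof -
    have "i \<in> X (max m n)" "j \<in> X (max m n)"
      using that mono[of m "max m n"] mono[of n "max m n"] by auto
    then have "G i j \<inter> I \<subseteq> X (Suc (max m n))" by (auto simp: XSuc)
    then show ?thesis by blast
  qed
  moreover have "(\<Union>n. X n) \<subseteq> I" "countable (\<Union>n. X n)" using X by auto
  ultimately have "(\<Union>n. X n) \<in> ?C" by auto
  moreover have "x \<subseteq> (\<Union>n. X n)" using X0 by blast
  ultimately show "\<exists>y \<in> ?C. x \<subseteq> y" by blast
next
  fix \<xi> and f :: "nat set \<Rightarrow> 'a set"
  assume \<xi>: "\<xi> \<in> Field omega1"
    and f: "\<forall>i \<in> underS omega1 \<xi>. f i \<in> ?C"
    and mono: "\<forall>i \<in> underS omega1 \<xi>. \<forall>j \<in> underS omega1 \<xi>. (i, j) \<in> omega1 \<longrightarrow> f i \<subseteq> f j"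
  have wo1: "wo_rel omega1"
    using omega1_Card_order unfolding card_order_on_def wo_rel_def by (rule conjunct1)
  have "countable (underS omega1 \<xi>)"
    using card_of_underS[OF omega1_Card_order \<xi>] ordLess_omega1_iff_countable by blast
  then have "countable (\<Union>i \<in> underS omega1 \<xi>. f i)" using f by (intro countable_UN) auto
  moreover have "(\<Union>i \<in> underS omega1 \<xi>. f i) \<subseteq> I" using f by auto
  moreover have "G i j \<inter> I \<subseteq> (\<Union>a \<in> underS omega1 \<xi>. f a)"
    if ij: "i \<in> f a" "j \<in> f b" "a \<in> underS omega1 \<xi>" "b \<in> underS omega1 \<xi>" for i j a b
  proof -
    have "a \<in> Field omega1" "b \<in> Field omega1" using ij(3,4) underS_Field by fast+
    then consider "(a, b) \<in> omega1" | "(b, a) \<in> omega1"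
      using wo_rel.TOTALS[OF wo1] by blast
    then obtain d where d: "d \<in> underS omega1 \<xi>" "i \<in> f d" "j \<in> f d"
    proof cases
      case 1
      then show ?thesis using mono ij that[of b] by blast
    next
      case 2
      then show ?thesis using mono ij that[of a] by blast
    qed
    have "f d \<in> ?C" using f d(1) by (rule bspec)
    then have "G i j \<inter> I \<subseteq> f d" using d(2,3) by simp
    then show ?thesis by (rule order_trans[OF _ UN_upper[OF d(1)]])
  qed
  then have "\<forall>i \<in> (\<Union>a \<in> underS omega1 \<xi>. f a). \<forall>j \<in> (\<Union>a \<in> underS omega1 \<xi>. f a).
      G i j \<inter> I \<subseteq> (\<Union>a \<in> underS omega1 \<xi>. f a)"
    by (intro ballI) (elim UN_E)
  ultimately show "(\<Union>i \<in> underS omega1 \<xi>. f i) \<in> ?C" by (intro CollectI conjI)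
qed

context square_sequence
begin

lemma not_SSR: "\<not> SSR r"
proof
  assume SSR: "SSR r"
  obtain \<eta> where \<eta>: "\<eta> \<in> Field r" "uncountable (traces \<eta>)"
    using uncountable_traces by blast
  have "|omega1_in r| \<le>o |traces \<eta>|"
    using card_omega1_in \<eta>(2) unfolding uncountable_iff_omega1_ordLeq
    by (rule ordIso_ordLeq_trans)
  then obtain c where c: "inj_on c (omega1_in r)" "c ` omega1_in r \<subseteq> traces \<eta>"
    using card_of_ordLeq[of "omega1_in r" "traces \<eta>"] by blast
  let ?L = "lim_points r (Field r)"
  \<comment> \<open>Requiring \<eta> < \<beta> removes only a null set, and lets traces below \<eta>
    be compared through coherence at \<beta>.\<close>
  define A where "A \<xi> = {\<beta> \<in> Field r. \<eta> \<lhd> \<beta> \<and> C \<beta> \<inter> underS r \<eta> = c \<xi>}" for \<xi>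
  have A: "\<forall>\<xi> \<in> omega1_in r. \<not> null (A \<xi>)"
  proof (intro ballI notI)
    fix \<xi> assume \<xi>: "\<xi> \<in> omega1_in r"
    assume "null (A \<xi>)"
    then have "null (A \<xi> \<union> {\<beta>. \<beta> \<unlhd> \<eta>})" using null_bounded[OF \<eta>(1)] by (rule null_Un)
    moreover have "{\<beta> \<in> Field r. C \<beta> \<inter> underS r \<eta> = c \<xi>} \<subseteq> A \<xi> \<union> {\<beta>. \<beta> \<unlhd> \<eta>}"
      unfolding A_def using not_lt_iff[OF \<eta>(1)] by auto
    ultimately have "null {\<beta> \<in> Field r. C \<beta> \<inter> underS r \<eta> = c \<xi>}" by (rule null_subset)
    moreover have "c \<xi> \<in> traces \<eta>" using c(2) \<xi> by (rule subsetD[OF _ imageI])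
    ultimately show False unfolding traces_def by simp
  qed
  define captured where "captured y \<beta> \<xi> \<longleftrightarrow> \<xi> \<in> omega1_in r \<and> \<beta> \<in> ?L \<and> \<eta> \<lhd> \<beta> \<and>
    C \<beta> \<inter> underS r \<eta> = c \<xi> \<and> y \<subseteq> underS r \<beta> \<and>
    (\<forall>\<alpha>. \<alpha> \<lhd> \<beta> \<longrightarrow> (\<exists>\<gamma> \<in> y. \<alpha> \<lhd> \<gamma>)) \<and> y \<inter> omega1_in r = underS r \<xi>" for y \<beta> \<xi>
  define S where "S = {x \<in> omega_subsets (Field r). \<exists>y \<beta> \<xi>. captured y \<beta> \<xi> \<and> omega1_ext r y x}"
  have "full r S"
    unfolding full_def
  proof (intro ballI impI)
    fix x x' assume x: "x \<in> S" "x' \<in> omega_subsets (Field r)" "omega1_ext r x x'"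
    then obtain y \<beta> \<xi> where y: "captured y \<beta> \<xi>" "omega1_ext r y x" unfolding S_def by blast
    have "omega1_ext r y x'" using y(2) x(3) unfolding omega1_ext_def by auto
    then show "x' \<in> S" unfolding S_def using y(1) x(2) by blast
  qed
  moreover have S_sub: "S \<subseteq> omega_subsets (Field r)" unfolding S_def by blast
  moreover have "stationary_omega (Field r) S"
    unfolding stationary_omega_def stationary_small_def
  proof (intro conjI allI impI S_sub)
    show "S \<subseteq> small_subsets omega1 (Field r)"
    proof
      fix x assume "x \<in> S"
      then have "x \<in> omega_subsets (Field r)" using S_sub by blast
      then show "x \<in> small_subsets omega1 (Field r)"
        by (simp add: omega_subsets_iff small_subsets_omega1)
    qed
    fix \<C> :: "'a set set" assume "club_small omega1 (Field r) \<C>"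
    from club_meets_not_null[OF this A]
    obtain y \<xi> \<beta> where y: "y \<in> \<C>" "\<xi> \<in> omega1_in r" "\<beta> \<in> A \<xi>" "\<beta> \<in> cof_omega"
      "y \<in> omega_subsets (Field r)" "y \<subseteq> underS r \<beta>" "\<forall>\<alpha>. \<alpha> \<lhd> \<beta> \<longrightarrow> (\<exists>\<gamma> \<in> y. \<alpha> \<lhd> \<gamma>)"
      "y \<inter> omega1_in r = underS r \<xi>"
      by (elim bexE conjE)
    have "captured y \<beta> \<xi>"
      unfolding captured_def using y cof_omega_lim_points[OF y(4)] unfolding A_def by blast
    moreover have "omega1_ext r y y" unfolding omega1_ext_def by blast
    ultimately have "y \<in> S" unfolding S_def using y(5) by blast
    then show "S \<inter> \<C> \<noteq> {}" using y(1) by blast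
  qed
  ultimately obtain I where I: "I \<subseteq> Field r" "|I| =o omega1" "omega1_in r \<subseteq> I"
    "stationary_omega I (S \<inter> omega_subsets I)"
    using SSR unfolding SSR_def by meson
  \<comment> \<open>A bound of I outside I; it serves as the index i when no element of x reaches
    \<beta>.\<close>
  obtain t where t: "t \<in> Field r" "\<And>x. x \<in> I \<Longrightarrow> x \<lhd> t"
    using bounded[OF I(1) ordIso_ordLess_trans[OF I(2) omega1_lt]] by blast
  \<comment> \<open>The least strict upper bound of the part of I below i: its supremum if it has no
    largest element, and otherwise the successor of that element.\<close>
  have "\<exists>d \<in> Field r. (\<forall>x \<in> I. x \<lhd> i \<longrightarrow> x \<lhd> d) \<and> (\<forall>b. b \<lhd> d \<longrightarrow> (\<exists>x \<in> I. x \<lhd> i \<and> b \<unlhd> x))"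
    if i: "i \<in> Field r" for i
  proof -
    obtain d where d: "d \<in> Field r" "\<forall>x \<in> I. x \<lhd> i \<longrightarrow> x \<lhd> d"
      and least: "\<And>b. b \<lhd> d \<Longrightarrow> \<not> (\<forall>x \<in> I. x \<lhd> i \<longrightarrow> x \<lhd> b)"
      using least_exists[OF i, of "\<lambda>d. \<forall>x \<in> I. x \<lhd> i \<longrightarrow> x \<lhd> d"] by metis
    have "\<exists>x \<in> I. x \<lhd> i \<and> b \<unlhd> x" if "b \<lhd> d" for b
      using least[OF that] not_lt_iff I(1) lt_Field[OF that] by blast
    then show ?thesis using d by blast
  qed
  then obtain \<delta> where \<delta>: "\<And>i. i \<in> Field r \<Longrightarrow> \<delta> i \<in> Field r"
    "\<And>i x. i \<in> Field r \<Longrightarrow> x \<in> I \<Longrightarrow> x \<lhd> i \<Longrightarrow> x \<lhd> \<delta> i"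
    "\<And>i b. i \<in> Field r \<Longrightarrow> b \<lhd> \<delta> i \<Longrightarrow> \<exists>x \<in> I. x \<lhd> i \<and> b \<unlhd> x"
    by metis
  \<comment> \<open>If \<open>\<delta> i\<close> is a limit, some point of
    \<open>C (\<delta> i)\<close> lies above j and at most at p; otherwise p is the largest element
    of I below i. Closing x under such p transfers both facts below \<beta>.\<close>
  define good where "good i j p \<longleftrightarrow> p \<in> I \<and> p \<lhd> i \<and>
    (\<delta> i \<in> ?L \<longrightarrow> (\<exists>\<kappa> \<in> C (\<delta> i). j \<lhd> \<kappa> \<and> \<kappa> \<unlhd> p)) \<and>
    (\<delta> i \<notin> ?L \<longrightarrow> (\<forall>q \<in> I. q \<lhd> i \<longrightarrow> q \<unlhd> p))" for i j p
  have good: "\<exists>p. good i j p"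
    if ij: "j \<in> I" "j \<lhd> i" for i j
  proof -
    have i: "i \<in> Field r" using lt_Field[OF ij(2)] by blast
    have j: "j \<lhd> \<delta> i" using \<delta>(2)[OF i ij] .
    show ?thesis
    proof (cases "\<delta> i \<in> ?L")
      case True
      then have "limit_point r (Field r) (\<delta> i)" unfolding lim_points_def by simp
      then obtain j' where j': "j \<lhd> j'" "j' \<lhd> \<delta> i"
        using j unfolding limit_point_def by blast
      obtain \<kappa> where \<kappa>: "\<kappa> \<in> C (\<delta> i)" "j' \<unlhd> \<kappa>" "\<kappa> \<lhd> \<delta> i"
        using club[OF True] j'(2) unfolding club_in_def by blast
      obtain p where "p \<in> I" "p \<lhd> i" "\<kappa> \<unlhd> p" using \<delta>(3)[OF i \<kappa>(3)] by blast
      then show ?thesis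
        unfolding good_def using True \<kappa>(1) lt_le_trans[OF j'(1) \<kappa>(2)] by blast
    next
      case False
      then obtain b where b: "b \<lhd> \<delta> i" "\<And>\<gamma>. \<gamma> \<lhd> \<delta> i \<Longrightarrow> \<not> b \<lhd> \<gamma>"
        using j \<delta>(1)[OF i] lt_Field unfolding lim_points_def limit_point_def by blast
      obtain p where p: "p \<in> I" "p \<lhd> i" "b \<unlhd> p" using \<delta>(3)[OF i b(1)] by blast
      have "q \<unlhd> p" if q: "q \<in> I" "q \<lhd> i" for q
      proof -
        have "\<not> b \<lhd> q" using b(2) \<delta>(2)[OF i q] by blast
        then have "q \<unlhd> b" using not_lt_iff lt_Field[OF b(1)] lt_Field[OF q(2)] by blast
        then show ?thesis using p(3) le_trans by blast
      qed
      then show ?thesis unfolding good_def using False p by blast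
    qed
  qed
  define p where "p i j = (SOME p. good i j p)" for i j
  have "good i j (p i j)" if "j \<in> I" "j \<lhd> i" for i j
    unfolding p_def using good[OF that] by (rule someI_ex)
  then have p: "\<And>i j. j \<in> I \<Longrightarrow> j \<lhd> i \<Longrightarrow> p i j \<in> I \<and> p i j \<lhd> i"
    "\<And>i j. j \<in> I \<Longrightarrow> j \<lhd> i \<Longrightarrow> \<delta> i \<in> ?L \<Longrightarrow> \<exists>\<kappa> \<in> C (\<delta> i). j \<lhd> \<kappa> \<and> \<kappa> \<unlhd> p i j"
    "\<And>i j q. j \<in> I \<Longrightarrow> j \<lhd> i \<Longrightarrow> \<delta> i \<notin> ?L \<Longrightarrow> q \<in> I \<Longrightarrow> q \<lhd> i \<Longrightarrow> q \<unlhd> p i j"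
    unfolding good_def by blast+
  \<comment> \<open>Decodes \<xi> from the index i alone, using that c is injective.\<close>
  define z where "z i = inv_into (omega1_in r) c (C (\<delta> i) \<inter> underS r \<eta>)" for i
  have z: "z i = \<xi>" if "\<xi> \<in> omega1_in r" "c \<xi> = C (\<delta> i) \<inter> underS r \<eta>" for i \<xi>
    using inv_into_f_f[OF c(1) that(1)] that(2) unfolding z_def by simp
  \<comment> \<open>As t is not in I, closure of x never supplies it as an argument, so the values
    at t are included separately.\<close>
  define G where "G i j = {z i, z t, p i j, p t j}" for i j
  have "club_small omega1 I {x. x \<subseteq> I \<and> countable x \<and> (\<forall>i \<in> x. \<forall>j \<in> x. G i j \<inter> I \<subseteq> x)}"
    by (rule club_small_closed_sets) (simp add: G_def)
  then obtain x where x: "x \<in> S" "x \<subseteq> I" "\<And>i j. i \<in> x \<Longrightarrow> j \<in> x \<Longrightarrow> G i j \<inter> I \<subseteq> x"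
    using I(4) unfolding stationary_omega_def stationary_small_def by blast
  obtain y \<beta> \<xi> where y: "captured y \<beta> \<xi>" "omega1_ext r y x"
    using x(1) unfolding S_def by blast
  have \<xi>: "\<xi> \<in> omega1_in r" and \<beta>: "\<beta> \<in> ?L" "\<eta> \<lhd> \<beta>" "C \<beta> \<inter> underS r \<eta> = c \<xi>"
    and y\<beta>: "y \<subseteq> underS r \<beta>" and unb: "\<And>\<alpha>. \<alpha> \<lhd> \<beta> \<Longrightarrow> \<exists>\<gamma> \<in> y. \<alpha> \<lhd> \<gamma>"
    using y(1) unfolding captured_def by auto
  have yx: "y \<subseteq> x" and x1: "x \<inter> omega1_in r = underS r \<xi>"
    using y unfolding captured_def omega1_ext_def by auto
  have \<beta>F: "\<beta> \<in> Field r" using lt_Field[OF \<beta>(2)] by blast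
  have "\<not> t \<lhd> \<beta>"
  proof
    assume "t \<lhd> \<beta>"
    then obtain \<gamma> where "\<gamma> \<in> y" "t \<lhd> \<gamma>" using unb by blast
    moreover from this have "\<gamma> \<lhd> t" using t(2) yx x(2) by blast
    ultimately show False using lt_trans lt_irrefl by blast
  qed
  then have "\<beta> \<unlhd> t" using not_lt_iff t(1) \<beta>F by blast
  \<comment> \<open>By minimality of i, every element of x below i is below \<beta>.\<close>
  then obtain i where i: "i \<in> Field r" "(i \<in> x \<or> i = t) \<and> \<beta> \<unlhd> i"
    and least: "\<And>u. u \<lhd> i \<Longrightarrow> \<not> ((u \<in> x \<or> u = t) \<and> \<beta> \<unlhd> u)"
    using least_exists[OF t(1), of "\<lambda>i. (i \<in> x \<or> i = t) \<and> \<beta> \<unlhd> i"] by metis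
  have below: "u \<lhd> \<beta>" if u: "u \<in> x" "u \<lhd> i" for u
    using least[OF u(2)] u(1) not_lt_iff \<beta>F lt_Field[OF u(2)] by blast
  obtain \<gamma>0 where \<gamma>0: "\<gamma>0 \<in> y" using unb[OF \<beta>(2)] by blast
  have zx: "z i \<in> x" if "z i \<in> I"
    using i(2) x(3)[of i \<gamma>0] x(3)[of \<gamma>0 \<gamma>0] \<gamma>0 yx that unfolding G_def by auto
  have px: "p i j \<in> x" if "j \<in> x" "p i j \<in> I" for j
    using i(2) x(3)[of i j] x(3)[of j j] that unfolding G_def by auto
  have yi: "\<gamma> \<in> I \<and> \<gamma> \<lhd> i" if \<gamma>: "\<gamma> \<in> y" for \<gamma>
    using lt_le_trans[of \<gamma> \<beta> i] \<gamma> y\<beta> i(2) yx x(2) by blast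
  have "\<not> \<delta> i \<lhd> \<beta>"
  proof
    assume "\<delta> i \<lhd> \<beta>"
    then obtain \<gamma> where \<gamma>: "\<gamma> \<in> y" "\<delta> i \<lhd> \<gamma>" using unb by blast
    then have "\<gamma> \<lhd> \<delta> i" using yi[OF \<gamma>(1)] \<delta>(2)[OF i(1)] by blast
    then show False using lt_trans[OF \<gamma>(2)] lt_irrefl by blast
  qed
  then have "\<beta> \<unlhd> \<delta> i" using not_lt_iff \<delta>(1)[OF i(1)] \<beta>F by blast
  then consider "\<beta> = \<delta> i" | "\<beta> \<lhd> \<delta> i" using le_cases by blast
  then have "c \<xi> = C (\<delta> i) \<inter> underS r \<eta>"
  proof cases
    case 1
    then show ?thesis using \<beta>(3) by simp
  next
    case 2
    obtain m where m: "m \<in> I" "m \<lhd> i" "\<beta> \<unlhd> m" using \<delta>(3)[OF i(1) 2] by blast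
    \<comment> \<open>The point \<open>p i \<gamma>\<close> is in x by closure and below i, hence
      below \<beta>. So it cannot be the largest element of I below i, as m is at least
      \<beta>.\<close>
    have p\<beta>: "p i \<gamma> \<lhd> \<beta>" if \<gamma>: "\<gamma> \<in> y" for \<gamma>
      using p(1)[of \<gamma> i] yi[OF \<gamma>] px[of \<gamma>] yx \<gamma> below by blast
    have L: "\<delta> i \<in> ?L"
    proof (rule ccontr)
      assume "\<delta> i \<notin> ?L"
      then have "m \<unlhd> p i \<gamma>0" using p(3)[of \<gamma>0 i m] yi[OF \<gamma>0] m by blast
      then have "m \<lhd> \<beta>" using p\<beta>[OF \<gamma>0] le_lt_trans by blast
      then show False using m(3) lt_le_trans lt_irrefl by blast
    qed
    \<comment> \<open>Below \<beta>, points of \<open>C (\<delta> i)\<close> interleave with the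
      cofinal set y, so \<beta> is a limit point of \<open>C (\<delta> i)\<close>.\<close>
    have "\<exists>\<kappa> \<in> C (\<delta> i) \<inter> underS r \<beta>. \<alpha> \<lhd> \<kappa>" if \<alpha>: "\<alpha> \<lhd> \<beta>" for \<alpha>
    proof -
      obtain \<gamma> where \<gamma>: "\<gamma> \<in> y" "\<alpha> \<lhd> \<gamma>" using unb[OF \<alpha>] by blast
      obtain \<kappa> where \<kappa>: "\<kappa> \<in> C (\<delta> i)" "\<gamma> \<lhd> \<kappa>" "\<kappa> \<unlhd> p i \<gamma>"
        using p(2)[of \<gamma> i] yi[OF \<gamma>(1)] L by blast
      have "\<kappa> \<lhd> \<beta>" using \<kappa>(3) p\<beta>[OF \<gamma>(1)] by (rule le_lt_trans)
      moreover have "\<alpha> \<lhd> \<kappa>" using \<gamma>(2) \<kappa>(2) by (rule lt_trans)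
      ultimately show ?thesis using \<kappa>(1) by blast
    qed
    then have "limit_point r (C (\<delta> i)) \<beta>"
      unfolding limit_point_def using \<beta>F \<beta>(2) by blast
    then have "C \<beta> = C (\<delta> i) \<inter> underS r \<beta>" using C_limit_point(2)[OF L 2] by blast
    then show ?thesis using \<beta>(3) underS_mono[OF lt_imp_le[OF \<beta>(2)]] by blast
  qed
  \<comment> \<open>Closure puts \<xi> into x, although x contains exactly the countable ordinals
    below \<xi>.\<close>
  then have "z i = \<xi>" by (rule z[OF \<xi>])
  then have "\<xi> \<in> x \<inter> omega1_in r" using zx \<xi> I(3) by blast
  then show False unfolding x1 using lt_irrefl by blast
qed

end

theorem theorem2p1:
  fixes r :: "'a rel"
  assumes "Card_order r" and "regularCard r" and "omega2 \<le>o r"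
    and "SSR r"
  shows "\<not> square r"
proof
  assume "square r"
  then obtain C where C: "\<forall>\<alpha> \<in> lim_points r (Field r). club_in r (underS r \<alpha>) (C \<alpha>)"
    "\<forall>\<beta> \<in> lim_points r (Field r). \<forall>\<alpha> \<in> lim_points r (C \<beta>). C \<alpha> = C \<beta> \<inter> underS r \<alpha>"
    "\<not> (\<exists>D. club_in r (Field r) D \<and> (\<forall>\<alpha> \<in> lim_points r D. D \<inter> underS r \<alpha> = C \<alpha>))"
    unfolding square_def by (elim exE conjE)
  interpret square_sequence r C
  proof (intro square_sequence.intro regular_order.intro square_sequence_axioms.intro)
    show "club_in r (underS r \<alpha>) (C \<alpha>)" if "\<alpha> \<in> lim_points r (Field r)" for \<alpha>
      using C(1) that by blast
    show "C \<alpha> = C \<beta> \<inter> underS r \<alpha>"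
      if "\<beta> \<in> lim_points r (Field r)" "\<alpha> \<in> lim_points r (C \<beta>)" for \<alpha> \<beta>
      using C(2) that by blast
  qed (rule assms C(3))+
  show False using not_SSR assms(4) by blast
qed

end
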